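(* Let $n\in\mathbb N$, $n\ge 2$, be fixed, $\lambda=\frac{n-1}{2}$, and suppose that $a=L(n+L-1)$ for some $L\in\mathbb R\setminus\mathbb Z$. Let $L_0:=\max\{[L],[-n-L+1]\}$, where $[x]$ denotes the largest integer less than or equal to $x$. Denote by $G$ the zonal function on $\mathcal S^n$ with Gegenbauer expansion $$G:=\sum_{l=0}^\infty\frac{1}{a-l(n+l-1)}\,\frac{\lambda+l}{\lambda}\,\mathcal C_l^\lambda .$$ Then $$\begin{aligned} G(\cos\vartheta)=&-\int_0^1 R^{-(n+2L)}\int_0^R r^{n+L-2}\left(\Sigma_n\, p_r(\cos\vartheta)-\sum_{l=0}^{L_0}r^l\,\frac{\lambda+l}{\lambda}\,\mathcal C_l^\lambda(\cos\vartheta)\right)dr\,dR\\ &+\sum_{l=0}^{L_0}\frac{1}{a-l(n+l-1)}\,\frac{\lambda+l}{\lambda}\,\mathcal C_l^\lambda(\cos\vartheta), \end{aligned}$$ as an equality of zonal $\mathcal L^1(\mathcal S^n)$ functions (where, if $L_0<0$, the sums $\sum_{l=0}^{L_0}$ are set to be $0$).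
   Context: $\mathcal S^n\subset\mathbb R^{n+1}$ is the $n$-dimensional unit sphere with rotation-invariant surface measure of total mass $\Sigma_n=\frac{2\pi^{(n+1)/2}}{\Gamma((n+1)/2)}$. $\mathcal C_l^\lambda$ is the Gegenbauer polynomial of degree $l$ and order $\lambda$, defined by $\sum_{l\ge0}\mathcal C_l^\lambda(t)\,r^l=(1-2tr+r^2)^{-\lambda}$. $p_r$ is the Poisson kernel, $$p_r(\cos\vartheta)=\frac{1}{\Sigma_n}\sum_{l=0}^\infty r^l\,\frac{\lambda+l}{\lambda}\,\mathcal C_l^\lambda(\cos\vartheta)=\frac{1}{\Sigma_n}\,\frac{1-r^2}{(1-2r\cos\vartheta+r^2)^{(n+1)/2}},\qquad 0\le r<1 .$$ A zonal function on $\mathcal S^n$ is one that depends only on the first coordinate $t=x_1=\cos\vartheta$, $\vartheta\in[0,\pi]$, and is identified with a function of $t\in[-1,1]$. A zonal $\mathcal L^1(\mathcal S^n)$ function $g$ is represented by its Gegenbauer expansion $g=\sum_{l=0}^\infty\widehat g(l)\,\mathcal C_l^\lambda$, with $$\widehat g(l)=\frac{\int_{-1}^1 g(t)\,\mathcal C_l^\lambda(t)(1-t^2)^{\lambda-1/2}dt}{\int_{-1}^1 \mathcal C_l^\lambda(t)^2(1-t^2)^{\lambda-1/2}dt}.$$ Accordingly, the series defining $G$ means that $G$ is the zonal $\mathcal L^1(\mathcal S^n)$ function with the indicated Gegenbauer coefficients; pointwise convergence of the series is not meant. Equality of zonal $\mathcal L^1$ functions means equality for almost every $\vartheta\in[0,\pi]$.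 *)

theory Defs
  imports "HOL-Analysis.Analysis" "HOL-Computational_Algebra.Formal_Power_Series"
begin

section \<open>The sphere and its surface measure\<close>

text \<open>
  Points of the \<open>n\<close>-dimensional unit sphere are functions on the index set \<open>{..n}\<close>
  (extended by \<open>undefined\<close>); the first coordinate of \<open>x\<close> is \<open>x 0\<close>.
\<close>

definition unit_sphere :: "nat \<Rightarrow> (nat \<Rightarrow> real) set" where
  "unit_sphere n = {x \<in> {..n} \<rightarrow>\<^sub>E UNIV. (\<Sum>i\<le>n. (x i)\<^sup>2) = 1}"

definition sphere_area :: "nat \<Rightarrow> real" where
  "sphere_area n = 2 * pi powr ((real n + 1) / 2) / Gamma ((real n + 1) / 2)"

definition punctured_ball :: "nat \<Rightarrow> (nat \<Rightarrow> real) set" where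
  "punctured_ball n = {x \<in> {..n} \<rightarrow>\<^sub>E UNIV. 0 < L2_set x {..n} \<and> L2_set x {..n} \<le> 1}"

definition radial_projection :: "nat \<Rightarrow> (nat \<Rightarrow> real) \<Rightarrow> (nat \<Rightarrow> real)" where
  "radial_projection n x = (\<lambda>i\<in>{..n}. x i / L2_set x {..n})"

text \<open>
  The surface measure of \<open>A\<close> is \<open>n + 1\<close> times the Lebesgue measure of the cone
  \<open>{r x | 0 < r \<le> 1, x \<in> A}\<close>.
\<close>

definition sphere_measure :: "nat \<Rightarrow> (nat \<Rightarrow> real) measure" where
  "sphere_measure n = scale_measure (of_nat (n + 1))
     (distr (restrict_space (\<Pi>\<^sub>M i\<in>{..n}. lborel) (punctured_ball n))
            (restrict_space (\<Pi>\<^sub>M i\<in>{..n}. borel) (unit_sphere n))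
            (radial_projection n))"

lemma radial_projection_measurable:
  "radial_projection n \<in>
     restrict_space (\<Pi>\<^sub>M i\<in>{..n}. lborel) (punctured_ball n) \<rightarrow>\<^sub>M
     restrict_space (\<Pi>\<^sub>M i\<in>{..n}. borel) (unit_sphere n)"
proof (rule measurable_restrict_space2)
  have "radial_projection n x \<in> unit_sphere n" if "x \<in> punctured_ball n" for x
  proof -
    have pos: "0 < L2_set x {..n}"
      using that by (simp add: punctured_ball_def)
    have "(\<Sum>i\<le>n. (radial_projection n x i)\<^sup>2) = (\<Sum>i\<le>n. (x i)\<^sup>2 / (L2_set x {..n})\<^sup>2)"
      by (intro sum.cong) (auto simp: radial_projection_def power_divide)
    also have "\<dots> = (L2_set x {..n})\<^sup>2 / (L2_set x {..n})\<^sup>2"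
      by (simp add: sum_divide_distrib[symmetric] L2_set_def sum_nonneg)
    also have "\<dots> = 1" using pos by simp
    finally show ?thesis by (simp add: unit_sphere_def radial_projection_def)
  qed
  then show "radial_projection n \<in>
      space (restrict_space (\<Pi>\<^sub>M i\<in>{..n}. lborel) (punctured_ball n)) \<rightarrow> unit_sphere n"
    by (auto simp: space_restrict_space)
  have "radial_projection n \<in> (\<Pi>\<^sub>M i\<in>{..n}. lborel) \<rightarrow>\<^sub>M (\<Pi>\<^sub>M i\<in>{..n}. borel)"
    unfolding radial_projection_def L2_set_def by measurable
  then show "radial_projection n \<in>
      restrict_space (\<Pi>\<^sub>M i\<in>{..n}. lborel) (punctured_ball n) \<rightarrow>\<^sub>M (\<Pi>\<^sub>M i\<in>{..n}. borel)"
    by (rule measurable_restrict_space1)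
qed

lemma emeasure_punctured_ball:
  "emeasure (\<Pi>\<^sub>M i\<in>{..n}. lborel) (punctured_ball n) = ennreal (unit_ball_vol (real n + 1))"
  and punctured_ball_sets: "punctured_ball n \<in> sets (\<Pi>\<^sub>M i\<in>{..n}. lborel)"
proof -
  let ?P = "\<Pi>\<^sub>M i\<in>{..n}. (lborel :: real measure)"
  interpret product_sigma_finite "\<lambda>_::nat. lborel :: real measure" ..
  define B where "B = {f. sqrt (\<Sum>i\<in>{..n}. (f i)\<^sup>2) \<le> 1} \<inter> space ?P"
  define z where "z = (\<lambda>i\<in>{..n}. 0::real)"
  have B: "B \<in> sets ?P"
    unfolding B_def by measurable
  have z: "{z} = (\<Pi>\<^sub>E i\<in>{..n}. {0})"
    by (auto simp: z_def PiE_def extensional_def fun_eq_iff)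
  have z_sets: "{z} \<in> sets ?P"
    unfolding z by (intro sets_PiM_I_finite) auto
  have z_null: "emeasure ?P {z} = 0"
    unfolding z by (subst emeasure_PiM) auto
  have eq: "punctured_ball n = B - {z}"
  proof (intro equalityI subsetI)
    fix x assume x: "x \<in> punctured_ball n"
    then have "x \<noteq> z"
      by (auto simp: punctured_ball_def z_def L2_set_def)
    with x show "x \<in> B - {z}"
      by (auto simp: B_def punctured_ball_def L2_set_def space_PiM)
  next
    fix x assume x: "x \<in> B - {z}"
    then obtain i where "i \<le> n" "x i \<noteq> 0"
      by (auto simp: B_def z_def space_PiM PiE_def extensional_def fun_eq_iff split: if_splits)
    then have "L2_set x {..n} \<noteq> 0"
      by (auto simp: L2_set_eq_0_iff)
    with L2_set_nonneg[of x "{..n}"] x show "x \<in> punctured_ball n"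
      by (auto simp: B_def punctured_ball_def L2_set_def space_PiM)
  qed
  show "punctured_ball n \<in> sets ?P"
    unfolding eq using B z_sets by auto
  have "emeasure ?P (punctured_ball n) = emeasure ?P B"
    unfolding eq by (rule emeasure_Diff_null_set) (use B z_sets z_null in auto)
  also have "\<dots> = ennreal (unit_ball_vol (real n + 1))"
    unfolding B_def by (subst emeasure_cball_aux) (auto simp: add.commute)
  finally show "emeasure ?P (punctured_ball n) = ennreal (unit_ball_vol (real n + 1))" .
qed

lemma emeasure_sphere_measure_space:
  "emeasure (sphere_measure n) (unit_sphere n) = ennreal (sphere_area n)"
proof -
  let ?P = "\<Pi>\<^sub>M i\<in>{..n}. (lborel :: real measure)"
  let ?R = "restrict_space ?P (punctured_ball n)"
  let ?S = "restrict_space (\<Pi>\<^sub>M i\<in>{..n}. (borel :: real measure)) (unit_sphere n)"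
  have spS: "space ?S = unit_sphere n"
    by (auto simp: space_restrict_space space_PiM unit_sphere_def)
  have spR: "space ?R = punctured_ball n"
    by (auto simp: space_restrict_space space_PiM punctured_ball_def)
  have "unit_sphere n \<in> sets ?S"
    using sets.top[of ?S] unfolding spS .
  then have "emeasure (distr ?R ?S (radial_projection n)) (unit_sphere n) =
      emeasure ?R (radial_projection n -` unit_sphere n \<inter> space ?R)"
    by (intro emeasure_distr radial_projection_measurable)
  also have "radial_projection n -` unit_sphere n \<inter> space ?R = punctured_ball n"
    using measurable_space[OF radial_projection_measurable[of n]] unfolding spS spR by auto
  also have "emeasure ?R (punctured_ball n) = emeasure ?P (punctured_ball n)"
    by (rule emeasure_restrict_space)
       (use punctured_ball_sets[of n] in \<open>auto simp: space_PiM punctured_ball_def\<close>)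
  also have "\<dots> = ennreal (unit_ball_vol (real n + 1))"
    by (rule emeasure_punctured_ball)
  finally have "emeasure (sphere_measure n) (unit_sphere n) =
      ennreal (real (n + 1)) * ennreal (unit_ball_vol (real n + 1))"
    by (simp add: sphere_measure_def ennreal_of_nat_eq_real_of_nat)
  also have "\<dots> = ennreal (real (n + 1) * unit_ball_vol (real n + 1))"
    by (subst ennreal_mult) auto
  also have "real (n + 1) * unit_ball_vol (real n + 1) = sphere_area n"
  proof -
    have "Gamma ((real n + 1) / 2 + 1) = (real n + 1) / 2 * Gamma ((real n + 1) / 2)"
      by (rule Gamma_plus1) (auto elim!: nonpos_Ints_cases)
    moreover have "Gamma ((real n + 1) / 2) \<noteq> 0"
      by (rule less_imp_neq[symmetric], rule Gamma_real_pos) simp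
    moreover have "Gamma ((real n + 1) / 2 + 1) \<noteq> 0"
      by (rule less_imp_neq[symmetric], rule Gamma_real_pos) (simp add: add_pos_pos)
    ultimately show ?thesis
      unfolding unit_ball_vol_def sphere_area_def by (simp add: divide_simps add_ac)
  qed
  finally show ?thesis .
qed


section \<open>Gegenbauer polynomials and the Poisson kernel\<close>

text \<open>
  The \<open>l\<close>-th coefficient, as a formal power series in \<open>r\<close>, of \<open>(1 - 2 t r + r\<^sup>2) powr (- lam)\<close>,
  that is, of the binomial series \<open>(1 + u) powr (- lam)\<close> composed with \<open>u = - 2 t r + r\<^sup>2\<close>.
\<close>

definition gegenbauer :: "real \<Rightarrow> nat \<Rightarrow> real \<Rightarrow> real" where
  "gegenbauer lam l t =
     fps_nth (fps_compose (fps_binomial (- lam)) (- fps_const (2 * t) * fps_X + fps_X\<^sup>2)) l"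

definition poisson_kernel :: "nat \<Rightarrow> real \<Rightarrow> real \<Rightarrow> real" where
  "poisson_kernel n r t =
     (let lam = (real n - 1) / 2
      in 1 / sphere_area n * (\<Sum>l. r ^ l * ((lam + real l) / lam) * gegenbauer lam l t))"


section \<open>Zonal functions and Gegenbauer expansions\<close>

text \<open>A zonal function is given by its profile \<open>g\<close>, a function of the first coordinate.\<close>

definition zonal_L1 :: "nat \<Rightarrow> (real \<Rightarrow> real) \<Rightarrow> bool" where
  "zonal_L1 n g \<longleftrightarrow> integrable (sphere_measure n) (\<lambda>x. g (x 0))"

definition gegenbauer_coeff :: "real \<Rightarrow> (real \<Rightarrow> real) \<Rightarrow> nat \<Rightarrow> real" where
  "gegenbauer_coeff lam g l =
     (LBINT t:{-1..1}. g t * gegenbauer lam l t * (1 - t\<^sup>2) powr (lam - 1/2)) /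
     (LBINT t:{-1..1}. (gegenbauer lam l t)\<^sup>2 * (1 - t\<^sup>2) powr (lam - 1/2))"

definition has_gegenbauer_expansion :: "nat \<Rightarrow> (real \<Rightarrow> real) \<Rightarrow> (nat \<Rightarrow> real) \<Rightarrow> bool" where
  "has_gegenbauer_expansion n g c \<longleftrightarrow>
     zonal_L1 n g \<and> (\<forall>l. gegenbauer_coeff ((real n - 1) / 2) g l = c l)"

end

theory Submission
  imports Defs
begin

text \<open>
  With \<open>m = L0 + 1\<close> (or \<open>0\<close>), the remainder \<open>rest\<close> is the series of
  \<open>r ^ l * (lam + l) / lam * C l t\<close> over \<open>l \<ge> m\<close>, and the two integrations send \<open>r ^ l\<close> to
  \<open>1 / ((l - L) * (n + L + l - 1)) = - 1 / (a - l * (n + l - 1))\<close>; the choice of \<open>L0\<close> makes all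
  exponents integrable at \<open>0\<close>. This termwise computation is justified on the level of coefficients:
  the \<open>L\<^sup>1\<close> norm of \<open>rest\<close> in \<open>t\<close> is \<open>O(r ^ m)\<close> uniformly on \<open>0 < r < 1\<close>, because the
  Poisson kernel is positive with constant mass, so the triple integral over \<open>(t, R, r)\<close> converges
  absolutely and Fubini's theorem yields both integrability of the right-hand side and its Gegenbauer
  coefficients. Zonal integrable functions are determined by their Gegenbauer coefficients
  (Weierstrass approximation), which gives the equality almost everywhere.
\<close>

section \<open>Gegenbauer polynomials\<close>

text \<open>The exponents come from the factorization a - l (n + l - 1) = (L - l) (n + L + l - 1):
  integrating r^(n + L - 2 + l) over (0, R) produces the second factor, and R^(-(n + 2 L)) turns the
  result into R^(l - L - 1), whose integral over (0, 1) gives the first. The obstacle sits at r = 1.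
  The only termwise majorant, the Poisson series at t = 1, equals (1 + r) / (1 - r)^n, which for n
  >= 2 is too large for the double integral, so series and integrals cannot be interchanged by
  domination. Averaging over t removes the singularity, hence the detour through coefficients and a
  conclusion for almost every t. Two definitions must be opened first. \<open>gegenbauer\<close> is
  a formal coefficient, and its analytic properties come from the factorization 1 - 2 t r + r^2 = (1
  - u r) (1 - cnj u r) with |u| = 1, Re u = t. The surface measure is a cone volume, and its image
  under the first coordinate has to be computed before \<open>zonal_L1\<close> can be compared with
  integrability against the Gegenbauer weight.\<close>

lemma fps_gegenbauer_recursion:
  fixes F :: "'a::field_char_0 fps"
  assumes "(1 - fps_const (2 * t) * fps_X + fps_X\<^sup>2) * fps_deriv F =
    fps_const (2 * lam) * (fps_const t - fps_X) * F"
  shows "fps_nth F (Suc 0) = 2 * lam * t * fps_nth F 0"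
    and "of_nat (Suc (Suc l)) * fps_nth F (Suc (Suc l)) =
      2 * t * (of_nat (Suc l) + lam) * fps_nth F (Suc l) - (of_nat l + 2 * lam) * fps_nth F l"
proof -
  \<comment> \<open>Comparing coefficients gives the recursion. The field stays general because the
    recursion serves the real generating series and also a complex product of conjugate binomial
    series.\<close>
  have nth: "fps_nth ((1 - fps_const (2 * t) * fps_X + fps_X * fps_X) * fps_deriv F) k =
      fps_nth (fps_const (2 * lam) * (fps_const t - fps_X) * F) k" for k
    using assms by (simp add: power2_eq_square)
  show "fps_nth F (Suc 0) = 2 * lam * t * fps_nth F 0"
    using nth[of 0] by (simp add: ring_distribs mult.assoc)
  show "of_nat (Suc (Suc l)) * fps_nth F (Suc (Suc l)) =
      2 * t * (of_nat (Suc l) + lam) * fps_nth F (Suc l) - (of_nat l + 2 * lam) * fps_nth F l"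
    using nth[of "Suc l"] 
    by (cases l) (simp_all add: ring_distribs mult.assoc; simp add: algebra_simps)+
qed

text \<open>Chain rule applied to (1 + X) B' = c B for the binomial series B. The constant term of V
  has to vanish for composition to respect products and derivatives.\<close>

lemma fps_compose_binomial_ODE:
  fixes V :: "'a::field_char_0 fps"
  assumes "fps_nth V 0 = 0"
  shows "(1 + V) * fps_deriv (fps_compose (fps_binomial c) V) =
    fps_const c * fps_compose (fps_binomial c) V * fps_deriv V"
proof -
  have "(1 + fps_X) * fps_deriv (fps_binomial c :: 'a fps) = fps_const c * fps_binomial c"
    by (simp add: fps_binomial_deriv fps_times_divide_eq)
  then have "fps_compose ((1 + fps_X) * fps_deriv (fps_binomial c)) V =
      fps_compose (fps_const c * fps_binomial c) V"
    by simp
  then have "(1 + V) * fps_compose (fps_deriv (fps_binomial c)) V =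
      fps_const c * fps_compose (fps_binomial c) V"
    using assms by (simp add: fps_compose_mult_distrib fps_compose_add_distrib)
  then show ?thesis
    using assms by (simp add: fps_compose_deriv mult.assoc[symmetric])
qed

lemma gegenbauer_0 [simp]: "gegenbauer lam 0 t = 1"
  by (simp add: gegenbauer_def)

lemma
  shows gegenbauer_1: "gegenbauer lam (Suc 0) t = 2 * lam * t"
    and gegenbauer_Suc_Suc: "real (Suc (Suc l)) * gegenbauer lam (Suc (Suc l)) t =
      2 * t * (real (Suc l) + lam) * gegenbauer lam (Suc l) t
      - (real l + 2 * lam) * gegenbauer lam l t"
proof -
  define V where "V = - fps_const (2 * t) * fps_X + fps_X\<^sup>2"
  define F where "F = fps_compose (fps_binomial (- lam)) V"
  have "(1 + V) * fps_deriv F = fps_const (- lam) * F * fps_deriv V"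
    unfolding F_def by (rule fps_compose_binomial_ODE) (simp add: V_def)
  moreover have "fps_deriv V = fps_const (- 2) * (fps_const t - fps_X)"
  proof -
    have "fps_X + fps_X = fps_const 2 * (fps_X :: real fps)"
      by (simp add: numeral_fps_const)
    then have "fps_deriv V = - fps_const (2 * t) + fps_const 2 * fps_X"
      by (simp add: V_def power2_eq_square)
    then show ?thesis
      by (simp add: fps_eq_iff)
  qed
  moreover have "1 + V = 1 - fps_const (2 * t) * fps_X + fps_X\<^sup>2"
    by (simp add: V_def fps_const_neg[symmetric] del: fps_const_neg)
  moreover have "fps_const (2 * lam) = fps_const (- lam) * fps_const (- 2)"
    by simp
  ultimately have ode: "(1 - fps_const (2 * t) * fps_X + fps_X\<^sup>2) * fps_deriv F =
      fps_const (2 * lam) * (fps_const t - fps_X) * F"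
    by (simp only: mult_ac)
  have F: "fps_nth F l = gegenbauer lam l t" for l
    by (simp add: F_def V_def gegenbauer_def)
  show "gegenbauer lam (Suc 0) t = 2 * lam * t"
    using fps_gegenbauer_recursion(1)[OF ode] by (simp add: F)
  show "real (Suc (Suc l)) * gegenbauer lam (Suc (Suc l)) t =
      2 * t * (real (Suc l) + lam) * gegenbauer lam (Suc l) t
      - (real l + 2 * lam) * gegenbauer lam l t"
    using fps_gegenbauer_recursion(2)[OF ode, of l] by (simp add: F)
qed

text \<open>The three-term recursion replayed in \<open>real poly\<close>, which makes degree,
  leading coefficient and derivative available.\<close>

fun gegenbauer_poly :: "real \<Rightarrow> nat \<Rightarrow> real poly" where
  "gegenbauer_poly lam 0 = 1"
| "gegenbauer_poly lam (Suc 0) = [:0, 2 * lam:]"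
| "gegenbauer_poly lam (Suc (Suc l)) = smult (1 / real (Suc (Suc l)))
     (smult (2 * (real (Suc l) + lam)) (pCons 0 (gegenbauer_poly lam (Suc l)))
      - smult (real l + 2 * lam) (gegenbauer_poly lam l))"

lemma poly_gegenbauer_poly: "poly (gegenbauer_poly lam l) t = gegenbauer lam l t"
proof (induction lam l rule: gegenbauer_poly.induct)
  case (3 lam l)
  have "gegenbauer lam (Suc (Suc l)) t =
      1 / real (Suc (Suc l)) * (real (Suc (Suc l)) * gegenbauer lam (Suc (Suc l)) t)"
    by simp
  then show ?case
    unfolding gegenbauer_Suc_Suc
    by (simp only: gegenbauer_poly.simps poly_smult poly_diff poly_pCons 3) (simp add: algebra_simps)
qed (simp_all add: gegenbauer_1)

lemma degree_gegenbauer_poly: "degree (gegenbauer_poly lam l) \<le> l"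
proof (induction lam l rule: gegenbauer_poly.induct)
  case (3 lam l)
  have "degree (pCons 0 (gegenbauer_poly lam (Suc l))) \<le> Suc (Suc l)"
    using 3(1) by (simp add: degree_pCons_eq_if)
  then show ?case
    using 3(2) by (auto intro!: degree_diff_le order.trans[OF degree_smult_le])
qed auto

text \<open>Each step multiplies the leading coefficient by 2 (l + 1 + lam) / (l + 2). The
  completeness proof divides by it.\<close>

lemma coeff_gegenbauer_poly_pos:
  assumes "lam > 0"
  shows "coeff (gegenbauer_poly lam l) l > 0"
  using assms
proof (induction lam l rule: gegenbauer_poly.induct)
  case (3 lam l)
  have "coeff (gegenbauer_poly lam l) (Suc (Suc l)) = 0"
    using degree_gegenbauer_poly[of lam l] by (intro coeff_eq_0) simp
  then show ?case
    using 3 by (auto intro!: divide_pos_pos mult_pos_pos add_pos_pos)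
qed auto

section \<open>Derivative identities and the Gegenbauer differential equation\<close>

abbreviation gegenbauer' :: "real \<Rightarrow> nat \<Rightarrow> real \<Rightarrow> real" where
  "gegenbauer' lam l t \<equiv> poly (pderiv (gegenbauer_poly lam l)) t"

lemma gegenbauer_has_derivative:
  "(gegenbauer lam l has_real_derivative gegenbauer' lam l t) (at t within S)"
  using poly_DERIV[of "gegenbauer_poly lam l" t] 
  by (simp add: poly_gegenbauer_poly has_field_derivative_at_within)

lemma gegenbauer'_Suc_Suc:
  "real (Suc (Suc l)) * gegenbauer' lam (Suc (Suc l)) t =
    2 * (real (Suc l) + lam) * (gegenbauer lam (Suc l) t + t * gegenbauer' lam (Suc l) t)
    - (real l + 2 * lam) * gegenbauer' lam l t"
proof -
  have "gegenbauer' lam (Suc (Suc l)) t = 1 / real (Suc (Suc l)) * (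
      2 * (real (Suc l) + lam) * (gegenbauer lam (Suc l) t + t * gegenbauer' lam (Suc l) t)
      - (real l + 2 * lam) * gegenbauer' lam l t)"
    by (simp only: gegenbauer_poly.simps pderiv_smult pderiv_diff pderiv_pCons
        poly_smult poly_diff poly_add poly_pCons poly_gegenbauer_poly) simp
  then show ?thesis by simp
qed

text \<open>Neither identity is inductive alone: the step for each uses both at the previous index,
  so they are proved together.\<close>

lemma gegenbauer'_identities:
  shows "real (Suc l) * gegenbauer lam (Suc l) t = t * gegenbauer' lam (Suc l) t - gegenbauer' lam l t"
    and "(real l + 2 * lam) * gegenbauer lam l t = gegenbauer' lam (Suc l) t - t * gegenbauer' lam l t"
proof (induction l)
  case 0
  {
    case 1 show ?case by (simp add: gegenbauer_1 pderiv_pCons)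
  next
    case 2 show ?case by (simp add: gegenbauer_1 pderiv_pCons)
  }
next
  case (Suc l)
  define A B C a b c where defs: "A = gegenbauer lam l t" "B = gegenbauer lam (Suc l) t"
    "C = gegenbauer lam (Suc (Suc l)) t" "a = gegenbauer' lam l t" "b = gegenbauer' lam (Suc l) t"
    "c = gegenbauer' lam (Suc (Suc l)) t"
  define k where "k = real (Suc l)"
  have k: "real l = k - 1" "real (Suc l) = k" "real (Suc (Suc l)) = k + 1" "k + 1 \<noteq> 0"
    by (simp_all add: k_def)
  have i: "k * B = t * b - a" and ii: "(k - 1 + 2 * lam) * A = b - t * a"
    using Suc by (simp_all only: defs k)
  have r: "(k + 1) * C = 2 * t * (k + lam) * B - (k - 1 + 2 * lam) * A"
    using gegenbauer_Suc_Suc[of l lam t] by (simp only: defs k)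
  have r': "(k + 1) * c = 2 * (k + lam) * (B + t * b) - (k - 1 + 2 * lam) * a"
    using gegenbauer'_Suc_Suc[of l lam t] by (simp only: defs k)
  have "a = t * b - k * B" using i by simp
  \<comment> \<open>After substituting for a, the coefficient of B is k^2 + k + 2 lam k + 2 lam = (k
    + 1) (k + 2 lam), so k + 1 cancels.\<close>
  then have "(k + 1) * c = (k + 1) * ((k + 2 * lam) * B + t * b)"
    using r' by algebra
  then have c: "c = (k + 2 * lam) * B + t * b"
    using k(4) mult_left_cancel by blast
  have "t * a = t * (t * b - k * B)" using i by simp
  then have "(k + 1) * C = t * c - b"
    unfolding r c ii by (simp add: algebra_simps)
  {
    case 1 show ?case using \<open>(k + 1) * C = t * c - b\<close> by (simp only: defs k)
  next
    case 2 show ?case using c by (simp only: defs k)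
  }
qed

text \<open>Eliminating \<open>gegenbauer' lam l t\<close> from the two identities leaves the factor
  1 - t^2. At t = 1 the derivative disappears and consecutive values are proportional.\<close>

lemma one_minus_square_gegenbauer':
  "(1 - t\<^sup>2) * gegenbauer' lam (Suc l) t =
    (real l + 2 * lam) * gegenbauer lam l t - real (Suc l) * t * gegenbauer lam (Suc l) t"
  using gegenbauer'_identities[of l lam t] by algebra

lemma gegenbauer_at_1_pos:
  assumes "lam > 0"
  shows "gegenbauer lam l 1 > 0"
proof (induction l)
  case (Suc l)
  have "real (Suc l) * gegenbauer lam (Suc l) 1 = (real l + 2 * lam) * gegenbauer lam l 1"
    using one_minus_square_gegenbauer'[of 1 lam l] by simp
  moreover have "\<dots> > 0" using Suc assms by simp
  ultimately show ?case
    by (metis of_nat_0_le_iff zero_less_mult_pos order_le_less mult_zero_left)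
qed simp

text \<open>This is the Gegenbauer equation (1 - t^2) C'' - (2 lam + 1) t C' + l (l + 2 lam) C = 0,
  written so that no second derivative has to be named.\<close>

lemma one_minus_square_gegenbauer'_has_derivative:
  "((\<lambda>t. (1 - t\<^sup>2) * gegenbauer' lam l t) has_real_derivative
    ((2 * lam - 1) * t * gegenbauer' lam l t - real l * (real l + 2 * lam) * gegenbauer lam l t)) (at t)"
proof (cases l)
  case 0
  then show ?thesis by simp
next
  case (Suc k)
  have "((\<lambda>t. (real k + 2 * lam) * gegenbauer lam k t - real (Suc k) * t * gegenbauer lam (Suc k) t)
      has_real_derivative ((real k + 2 * lam) * gegenbauer' lam k t
        - real (Suc k) * (gegenbauer lam (Suc k) t + t * gegenbauer' lam (Suc k) t))) (at t)"
    by (rule derivative_eq_intros gegenbauer_has_derivative refl | simp add: algebra_simps)+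
  moreover have "(real k + 2 * lam) * gegenbauer' lam k t
        - real (Suc k) * (gegenbauer lam (Suc k) t + t * gegenbauer' lam (Suc k) t) =
      (2 * lam - 1) * t * gegenbauer' lam l t - real l * (real l + 2 * lam) * gegenbauer lam l t"
  proof -
    have eq: "gegenbauer' lam k t =
        t * gegenbauer' lam (Suc k) t - real (Suc k) * gegenbauer lam (Suc k) t"
      using gegenbauer'_identities(1)[of k lam t] by simp
    show ?thesis
      unfolding Suc eq by (simp add: algebra_simps)
  qed
  ultimately show ?thesis
    unfolding Suc one_minus_square_gegenbauer' by simp
qed

section \<open>Orthogonality\<close>

text \<open>For lam = (n - 1) / 2 this is, up to a constant factor, the image of the surface measure
  under the first coordinate; see \<open>nn_integral_sphere_measure\<close>.\<close>

definition gegenbauer_measure :: "real \<Rightarrow> real measure" where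
  "gegenbauer_measure lam =
     density lborel (\<lambda>t. ennreal (indicator {-1..1} t * (1 - t\<^sup>2) powr (lam - 1/2)))"

lemma sets_gegenbauer_measure [simp, measurable_cong]: "sets (gegenbauer_measure lam) = sets borel"
  and space_gegenbauer_measure [simp]: "space (gegenbauer_measure lam) = UNIV"
  by (simp_all add: gegenbauer_measure_def)

lemma weight_measurable [measurable]: "(\<lambda>t::real. (1 - t\<^sup>2) powr s) \<in> borel_measurable borel"
  by measurable

lemma square_le_1_real: "t \<in> {-1..1} \<Longrightarrow> t\<^sup>2 \<le> (1::real)"
  by (simp add: abs_square_le_1 abs_le_iff)

lemma square_less_1_real: "t \<in> {-1<..<1} \<Longrightarrow> t\<^sup>2 < (1::real)"
  by (simp add: abs_square_less_1 abs_less_iff)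

text \<open>The bound lam >= 1/2, which is n >= 2, makes the exponent nonnegative, so the weight is
  at most 1.\<close>

lemma finite_gegenbauer_measure:
  assumes "lam \<ge> 1/2"
  shows "finite_measure (gegenbauer_measure lam)"
proof
  have "emeasure (gegenbauer_measure lam) (space (gegenbauer_measure lam)) =
      (\<integral>\<^sup>+t. ennreal (indicator {-1..1} t * (1 - t\<^sup>2) powr (lam - 1/2)) \<partial>lborel)"
    by (simp add: gegenbauer_measure_def emeasure_density)
  also have "\<dots> \<le> (\<integral>\<^sup>+t. indicator {-1..1::real} t \<partial>lborel)"
    using assms square_le_1_real
    by (intro nn_integral_mono) (auto split: split_indicator intro!: powr_le1)
  also have "\<dots> < \<infinity>"
    by simp
  finally show "emeasure (gegenbauer_measure lam) (space (gegenbauer_measure lam)) \<noteq> \<infinity>"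
    by simp
qed

lemma AE_gegenbauer_measure_iff:
  "(AE t in gegenbauer_measure lam. P t) \<longleftrightarrow> (AE t in lborel. t \<in> {-1..1} \<longrightarrow> P t)"
proof -
  \<comment> \<open>The endpoints are set aside because \<open>0 powr x = 0\<close> for every x, so
    the weight vanishes there even when lam = 1/2.\<close>
  have "AE t in lborel. t \<noteq> (1::real) \<and> t \<noteq> - 1"
    using AE_lborel_singleton[of 1] AE_lborel_singleton[of "-1"] by eventually_elim auto
  moreover have "0 < (1 - t\<^sup>2) powr (lam - 1/2)" if "t \<in> {-1..1}" "t \<noteq> 1 \<and> t \<noteq> -1" for t :: real
    using square_less_1_real[of t] that by auto
  ultimately have "AE t in lborel. 0 < ennreal (indicator {-1..1} t * (1 - t\<^sup>2) powr (lam - 1/2)) \<longleftrightarrow> t \<in> {-1..1}"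
    by (elim eventually_mono) (simp split: split_indicator)
  then show ?thesis
    unfolding gegenbauer_measure_def
    by (subst AE_density) (auto elim: eventually_elim2)
qed

lemma AE_gegenbauer_measure_interval: "AE t in gegenbauer_measure lam. t \<in> {-1..1}"
  by (subst AE_gegenbauer_measure_iff) auto

lemma
  fixes f :: "real \<Rightarrow> real"
  assumes [measurable]: "f \<in> borel_measurable borel"
  shows integrable_gegenbauer_measure_iff: "integrable (gegenbauer_measure lam) f \<longleftrightarrow>
      set_integrable lborel {-1..1} (\<lambda>t. f t * (1 - t\<^sup>2) powr (lam - 1/2))"
    and integral_gegenbauer_measure: "integral\<^sup>L (gegenbauer_measure lam) f =
      (LBINT t:{-1..1}. f t * (1 - t\<^sup>2) powr (lam - 1/2))"
  unfolding gegenbauer_measure_def set_integrable_def set_lebesgue_integral_def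
  by (simp_all add: integrable_density integral_density mult_ac)

lemma gegenbauer_continuous: "continuous_on S (gegenbauer lam l)"
  by (rule DERIV_continuous_on) (rule gegenbauer_has_derivative)

lemma gegenbauer_measurable [measurable]: "gegenbauer lam l \<in> borel_measurable borel"
  by (intro borel_measurable_continuous_onI gegenbauer_continuous)

lemma gegenbauer_bounded: "\<exists>B. \<forall>t\<in>{-1..1}. \<bar>gegenbauer lam l t\<bar> \<le> B"
proof -
  have "bounded (gegenbauer lam l ` {-1..1})"
    by (intro compact_imp_bounded compact_continuous_image gegenbauer_continuous) auto
  then show ?thesis
    by (auto simp: bounded_iff)
qed

lemma integrable_gegenbauer_measure_bounded:
  fixes f :: "real \<Rightarrow> real"
  assumes "lam \<ge> 1/2" "f \<in> borel_measurable borel" "\<And>t. t \<in> {-1..1} \<Longrightarrow> \<bar>f t\<bar> \<le> B"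
  shows "integrable (gegenbauer_measure lam) f"
  using assms(1,2)
  by (intro finite_measure.integrable_const_bound[OF finite_gegenbauer_measure, where B = B]
        eventually_mono[OF AE_gegenbauer_measure_interval]) (simp_all add: assms(3))

lemma integrable_mult_continuous:
  fixes f g :: "real \<Rightarrow> real"
  assumes "integrable (gegenbauer_measure lam) g" "continuous_on UNIV f"
  shows "integrable (gegenbauer_measure lam) (\<lambda>t. g t * f t)"
proof -
  have [measurable]: "g \<in> borel_measurable borel" "f \<in> borel_measurable borel"
    using borel_measurable_integrable[OF assms(1)] borel_measurable_continuous_onI[OF assms(2)] by simp_all
  have "bounded (f ` {-1..1})"
    using continuous_on_subset[OF assms(2)]
    by (intro compact_imp_bounded compact_continuous_image) auto
  then obtain B where "\<forall>y \<in> f ` {-1..1}. norm y \<le> B"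
    unfolding bounded_iff by blast
  then have B: "\<And>t. t \<in> {-1..1} \<Longrightarrow> \<bar>f t\<bar> \<le> B"
    by simp
  show ?thesis
  proof (rule Bochner_Integration.integrable_bound)
    show "integrable (gegenbauer_measure lam) (\<lambda>t. B * g t)"
      using assms by simp
    have "\<bar>g t\<bar> * \<bar>f t\<bar> \<le> \<bar>B\<bar> * \<bar>g t\<bar>" if "t \<in> {-1..1}" for t
      using B[OF that] by (subst mult.commute) (intro mult_right_mono, auto)
    then show "AE t in gegenbauer_measure lam. norm (g t * f t) \<le> norm (B * g t)"
      by (intro eventually_mono[OF AE_gegenbauer_measure_interval]) (simp add: abs_mult)
  qed measurable
qed

lemma integrable_mult_gegenbauer:
  assumes "integrable (gegenbauer_measure lam) f"
  shows "integrable (gegenbauer_measure lam) (\<lambda>t. f t * gegenbauer lam l t)"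
  using assms gegenbauer_continuous by (rule integrable_mult_continuous)

lemma integrable_gegenbauer:
  assumes "lam \<ge> 1/2"
  shows "integrable (gegenbauer_measure lam) (gegenbauer lam l)"
proof -
  obtain B where "\<forall>t\<in>{-1..1}. \<bar>gegenbauer lam l t\<bar> \<le> B"
    using gegenbauer_bounded by blast
  then show ?thesis
    using integrable_gegenbauer_measure_bounded[OF assms gegenbauer_measurable] by metis
qed

text \<open>Sturm-Liouville argument: for two eigenfunctions, the weighted Wronskian has as
  derivative the difference of the eigenvalues times the weighted product.\<close>

lemma weight_wronskian_has_derivative:
  fixes lam t :: real
  assumes "t \<in> {-1<..<1}"
  defines "C \<equiv> gegenbauer lam" and "C' \<equiv> gegenbauer' lam"
  shows "((\<lambda>t. (1 - t\<^sup>2) powr (lam + 1/2) * (C l t * C' m t - C' l t * C m t)) has_real_derivative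
    (real l * (real l + 2 * lam) - real m * (real m + 2 * lam)) *
      (C l t * C m t * (1 - t\<^sup>2) powr (lam - 1/2))) (at t)"
proof -
  \<comment> \<open>\<open>A\<close> absorbs one factor 1 - t^2 of the weight, so the differential
    equation applies as stated; the remaining first-order terms cancel against the derivative
    \<open>e\<close> of \<open>w\<close>.\<close>
  define A where "A l t = (1 - t\<^sup>2) * C' l t" for l t
  define A' where "A' l t = (2 * lam - 1) * t * C' l t - real l * (real l + 2 * lam) * C l t" for l t
  define w where "w t = (1 - t\<^sup>2) powr (lam - 1/2)" for t
  have pos: "1 - t\<^sup>2 > 0" if "t \<in> {-1<..<1}" for t :: real
    using square_less_1_real[OF that] by simp
  define e where "e = - (2 * lam - 1) * t * (w t / (1 - t\<^sup>2))"
  have e: "e * (1 - t\<^sup>2) = - (2 * lam - 1) * t * w t"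
    using pos[OF assms(1)] by (simp add: e_def)
  have w: "(w has_real_derivative e) (at t)"
  proof -
    have "((\<lambda>t. 1 - t\<^sup>2) has_real_derivative - 2 * t) (at t)"
      by (auto intro!: derivative_eq_intros)
    from DERIV_chain2[OF has_real_derivative_powr[OF pos[OF assms(1)]] this]
    have "(w has_real_derivative (lam - 1/2) * (1 - t\<^sup>2) powr (lam - 1/2 - 1) * (- 2 * t)) (at t)"
      unfolding w_def .
    moreover have "(1 - t\<^sup>2) powr (lam - 1/2 - 1) = w t / (1 - t\<^sup>2)"
      using pos[OF assms(1)] powr_diff[of "1 - t\<^sup>2" "lam - 1/2" 1] by (simp add: w_def)
    moreover have "(lam - 1/2) * x * (- 2 * t) = - (2 * lam - 1) * t * x" for x
      by (simp add: algebra_simps)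
    ultimately show ?thesis by (simp only: e_def)
  qed
  have C: "(C l has_real_derivative C' l t) (at t)" for l
    unfolding C_def C'_def by (rule gegenbauer_has_derivative)
  have A: "(A l has_real_derivative A' l t) (at t)" for l
    unfolding A_def A'_def C_def C'_def by (rule one_minus_square_gegenbauer'_has_derivative)
  have "((\<lambda>t. w t * (C l t * A m t - A l t * C m t)) has_real_derivative
      e * (C l t * A m t - A l t * C m t) +
      (C' l t * A m t + A' m t * C l t - (A' l t * C m t + C' m t * A l t)) * w t) (at t)"
    by (intro DERIV_mult DERIV_diff w C A)
  moreover have "e * (C l t * A m t - A l t * C m t) +
      (C' l t * A m t + A' m t * C l t - (A' l t * C m t + C' m t * A l t)) * w t =
      (real l * (real l + 2 * lam) - real m * (real m + 2 * lam)) * (C l t * C m t * w t)"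
  proof -
    have "e * (C l t * A m t - A l t * C m t) = e * (1 - t\<^sup>2) * (C l t * C' m t - C' l t * C m t)"
      by (simp add: A_def algebra_simps)
    then show ?thesis
      unfolding e by (simp add: A_def A'_def algebra_simps)
  qed
  ultimately have deriv: "((\<lambda>t. w t * (C l t * A m t - A l t * C m t)) has_real_derivative
      (real l * (real l + 2 * lam) - real m * (real m + 2 * lam)) * (C l t * C m t * w t)) (at t)"
    by simp
  \<comment> \<open>Splitting the power needs a positive base, so the two forms are compared on the
    open interval only.\<close>
  have eq: "w s * (C l s * A m s - A l s * C m s) =
      (1 - s\<^sup>2) powr (lam + 1/2) * (C l s * C' m s - C' l s * C m s)" if "s \<in> {-1<..<1}" for s
  proof -
    have *: "(1 - s\<^sup>2) powr (lam + 1/2) = w s * (1 - s\<^sup>2)"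
      using pos[OF that] powr_add[of "1 - s\<^sup>2" "lam - 1/2" 1] by (simp add: w_def add.commute)
    show ?thesis unfolding * A_def by (simp add: algebra_simps)
  qed
  show ?thesis
    using has_field_derivative_transform_within_open[OF deriv open_real_greaterThanLessThan assms(1) eq]
    unfolding w_def .
qed

text \<open>Integrate the Wronskian derivative over [-1, 1]. The boundary values vanish through the
  factor (1 - t^2)^(lam + 1/2), and the eigenvalue difference (l - m) (l + m + 2 lam) is
  nonzero.\<close>

lemma gegenbauer_orthogonal:
  assumes "lam \<ge> 1/2" "l \<noteq> m"
  shows "(\<integral>t. gegenbauer lam l t * gegenbauer lam m t \<partial>gegenbauer_measure lam) = 0"
proof -
  define F where "F t = (1 - t\<^sup>2) powr (lam + 1/2) *
    (gegenbauer lam l t * gegenbauer' lam m t - gegenbauer' lam l t * gegenbauer lam m t)" for t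
  define f where "f t = gegenbauer lam l t * gegenbauer lam m t * (1 - t\<^sup>2) powr (lam - 1/2)" for t
  define k where "k = real l * (real l + 2 * lam) - real m * (real m + 2 * lam)"
  have "k = (real l - real m) * (real l + real m + 2 * lam)"
    by (simp add: k_def algebra_simps)
  then have "k \<noteq> 0"
    using assms by auto
  have "((\<lambda>t. k * f t) has_integral F 1 - F (-1)) {-1..1}"
  proof (rule fundamental_theorem_of_calculus_interior)
    show "continuous_on {-1..1} F"
      unfolding F_def using assms square_le_1_real
      by (intro continuous_intros continuous_on_powr' gegenbauer_continuous) auto
    show "(F has_vector_derivative k * f t) (at t)" if "t \<in> {-1<..<1}" for t
      using weight_wronskian_has_derivative[OF that, of lam l m]
      unfolding F_def f_def k_def by (simp add: has_real_derivative_iff_has_vector_derivative)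
  qed simp
  then have "(f has_integral 0) {-1..1}"
    using has_integral_mult_right[of "\<lambda>t. k * f t" 0 "{-1..1}" "1 / k"] \<open>k \<noteq> 0\<close>
    by (simp add: F_def)
  moreover have int: "set_integrable lborel {-1..1} f"
    using integrable_mult_gegenbauer[OF integrable_gegenbauer[OF assms(1), of l], of m]
    unfolding f_def by (subst (asm) integrable_gegenbauer_measure_iff) simp_all
  ultimately have "(LBINT t:{-1..1}. f t) = 0"
    using set_borel_integral_eq_integral(2)[OF int] by (simp add: integral_unique)
  then show ?thesis
    unfolding f_def by (subst integral_gegenbauer_measure) simp_all
qed

definition gegenbauer_norm :: "real \<Rightarrow> nat \<Rightarrow> real" where
  "gegenbauer_norm lam l = (\<integral>t. gegenbauer lam l t * gegenbauer lam l t \<partial>gegenbauer_measure lam)"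

text \<open>The value at t = 1 is positive, so by continuity the square is positive on an interval
  to the left of 1, which has positive measure.\<close>

lemma gegenbauer_norm_pos:
  assumes "lam \<ge> 1/2"
  shows "gegenbauer_norm lam l > 0"
proof -
  let ?f = "\<lambda>t. gegenbauer lam l t * gegenbauer lam l t"
  have int: "integrable (gegenbauer_measure lam) ?f"
    by (intro integrable_mult_gegenbauer integrable_gegenbauer assms)
  have "gegenbauer_norm lam l \<ge> 0"
    unfolding gegenbauer_norm_def by (rule Bochner_Integration.integral_nonneg) simp
  moreover have "gegenbauer_norm lam l \<noteq> 0"
  proof
    assume "gegenbauer_norm lam l = 0"
    then have "AE t in gegenbauer_measure lam. ?f t = 0"
      unfolding gegenbauer_norm_def
      using integral_nonneg_eq_0_iff_AE[OF int] by simp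
    then have "AE t in lborel. t \<in> {-1..1} \<longrightarrow> gegenbauer lam l t = 0"
      by (subst (asm) AE_gegenbauer_measure_iff) simp_all
    moreover obtain d where d: "d > 0" "\<And>t. \<bar>t - 1\<bar> < d \<Longrightarrow> gegenbauer lam l t > 0"
    proof -
      have "isCont (gegenbauer lam l) 1"
        using gegenbauer_continuous[of UNIV] by (simp add: continuous_on_eq_continuous_at)
      then have "\<forall>\<^sub>F t in nhds 1. gegenbauer lam l t > 0"
        using gegenbauer_at_1_pos[of lam l] assms
        by (intro order_tendstoD(1)[of _ "gegenbauer lam l 1"])
           (auto simp: isCont_def tendsto_at_iff_tendsto_nhds)
      then obtain d where "d > 0" "\<forall>t. dist t 1 < d \<longrightarrow> gegenbauer lam l t > 0"
        unfolding eventually_nhds_metric by blast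
      then show ?thesis
        by (intro that[of d]) (simp_all add: dist_real_def)
    qed
    \<comment> \<open>The maximum with 0 keeps the interval inside [-1, 1].\<close>
    ultimately have "AE t in lborel. t \<notin> {max 0 (1 - d)<..<1}"
    proof (elim eventually_mono, intro impI notI)
      fix t assume "t \<in> {-1..1} \<longrightarrow> gegenbauer lam l t = 0" "t \<in> {max 0 (1 - d)<..<1}"
      with d(2)[of t] show False by auto
    qed
    then have "emeasure lborel {max 0 (1 - d)<..<1} = 0"
      by (subst (asm) AE_iff_measurable[OF _ refl]) (simp_all add: greaterThanLessThan_def greaterThan_def lessThan_def Int_def conj_ac)
    then show False using d by simp
  qed
  ultimately show ?thesis by simp
qed

lemma gegenbauer_coeff_eq:
  assumes [measurable]: "g \<in> borel_measurable borel"
  shows "gegenbauer_coeff lam g l =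
    (\<integral>t. g t * gegenbauer lam l t \<partial>gegenbauer_measure lam) / gegenbauer_norm lam l"
  unfolding gegenbauer_coeff_def gegenbauer_norm_def
  by (simp add: integral_gegenbauer_measure power2_eq_square)

section \<open>Generating function and Poisson kernel\<close>

text \<open>The coefficient of x^k in (1 - x)^(-lam). Unlike the binomial coefficients of -lam,
  these do not alternate in sign for lam > 0.\<close>

definition geometric_binomial :: "real \<Rightarrow> nat \<Rightarrow> real" where
  "geometric_binomial lam k = pochhammer lam k / fact k"

lemma geometric_binomial_nonneg: "lam > 0 \<Longrightarrow> geometric_binomial lam k \<ge> 0"
  by (simp add: geometric_binomial_def pochhammer_nonneg)

lemma gbinomial_minus_power:
  fixes u :: complex
  shows "((- of_real lam) gchoose k) * (- u) ^ k = of_real (geometric_binomial lam k) * u ^ k"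
proof -
  have "(- 1) ^ k * (- u) ^ k = u ^ k"
    by (simp flip: power_mult_distrib)
  then show ?thesis
    by (simp add: gbinomial_pochhammer geometric_binomial_def pochhammer_of_real mult_ac)
qed

text \<open>
  The product of the binomial series of \<open>(1 - u r) powr (- lam)\<close> and \<open>(1 - cnj u r) powr (- lam)\<close>
  solves the differential equation of the generating function.
\<close>

lemma gegenbauer_complex:
  fixes u :: complex
  assumes u: "norm u = 1"
  shows "of_real (gegenbauer lam l (Re u)) =
    (\<Sum>k\<le>l. (of_real (geometric_binomial lam k) * u ^ k) *
       (of_real (geometric_binomial lam (l - k)) * cnj u ^ (l - k)))"
proof -
  define A where "A v = fps_compose (fps_binomial (- complex_of_real lam)) (fps_const (- v) * fps_X)" for v
  have nth_A: "fps_nth (A v) k = of_real (geometric_binomial lam k) * v ^ k" for v k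
    unfolding A_def fps_compose_linear using gbinomial_minus_power[of lam k v] by (simp add: mult.commute)
  have ode_A: "(1 - fps_const v * fps_X) * fps_deriv (A v) = fps_const (of_real lam * v) * A v" for v
  proof -
    have "(1 + fps_const (- v) * fps_X) * fps_deriv (A v) =
        fps_const (- of_real lam) * A v * fps_deriv (fps_const (- v) * fps_X)"
      unfolding A_def by (rule fps_compose_binomial_ODE) simp
    also have "fps_deriv (fps_const (- v) * fps_X) = fps_const (- v)"
      by simp
    also have "fps_const (- of_real lam) * A v * fps_const (- v) = fps_const (of_real lam * v) * A v"
      by (simp add: mult.commute mult.left_commute flip: mult.assoc)
    finally show ?thesis
      by (simp flip: fps_const_neg)
  qed
  define F where "F = A u * A (cnj u)"
  define t where "t = complex_of_real (Re u)"
  define lc where "lc = complex_of_real lam"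
  have add: "u + cnj u = 2 * t" and mult: "u * cnj u = 1"
    using u by (simp_all add: t_def complex_add_cnj complex_norm_square[symmetric])
  have ode: "(1 - fps_const (2 * t) * fps_X + fps_X\<^sup>2) * fps_deriv F =
      fps_const (2 * lc) * (fps_const t - fps_X) * F"
  proof -
    define a b where "a = fps_const u" and "b = fps_const (cnj u)"
    have ab: "a + b = fps_const (2 * t)" "a * b = 1"
      using add mult by (simp_all add: a_def b_def)
    have oa: "(1 - a * fps_X) * fps_deriv (A u) = fps_const lc * a * A u"
      and ob: "(1 - b * fps_X) * fps_deriv (A (cnj u)) = fps_const lc * b * A (cnj u)"
      using ode_A[of u] ode_A[of "cnj u"] by (simp_all add: a_def b_def lc_def)
    have q: "1 - fps_const (2 * t) * fps_X + fps_X\<^sup>2 = (1 - a * fps_X) * (1 - b * fps_X)"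
    proof -
      have "(1 - a * fps_X) * (1 - b * fps_X) = 1 - (a + b) * fps_X + (a * b) * fps_X\<^sup>2"
        by (simp add: algebra_simps power2_eq_square)
      then show ?thesis by (simp add: ab)
    qed
    have "(1 - fps_const (2 * t) * fps_X + fps_X\<^sup>2) * fps_deriv F =
        (1 - b * fps_X) * A (cnj u) * ((1 - a * fps_X) * fps_deriv (A u))
        + (1 - a * fps_X) * A u * ((1 - b * fps_X) * fps_deriv (A (cnj u)))"
      unfolding q by (simp add: F_def algebra_simps)
    also have "\<dots> = fps_const lc * ((a + b) - (a * b + a * b) * fps_X) * F"
      unfolding oa ob by (simp add: F_def algebra_simps)
    also have "(a + b) - (a * b + a * b) * fps_X = fps_const 2 * (fps_const t - fps_X)"
    proof -
      have "a * b + a * b = fps_const 2" "a + b = fps_const 2 * fps_const t"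
        using ab by (simp_all add: numeral_fps_const)
      then show ?thesis by (simp only: right_diff_distrib)
    qed
    finally have "(1 - fps_const (2 * t) * fps_X + fps_X\<^sup>2) * fps_deriv F =
        fps_const lc * fps_const 2 * (fps_const t - fps_X) * F"
      by (simp only: mult.assoc)
    moreover have "fps_const lc * fps_const 2 = fps_const (2 * lc)"
      by (simp add: mult.commute)
    ultimately show ?thesis by (simp only:)
  qed
  \<comment> \<open>Both sequences satisfy the same two-step recursion, over the reals and over the
    complex numbers, and both start with 1.\<close>
  have "of_real (gegenbauer lam l (Re u)) = fps_nth F l"
  proof (induction l rule: induct_nat_012)
    case 0
    show ?case by (simp add: F_def nth_A geometric_binomial_def)
  next
    case 1
    show ?case
      using fps_gegenbauer_recursion(1)[OF ode]
      by (simp add: gegenbauer_1 F_def nth_A geometric_binomial_def t_def lc_def)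
  next
    case (ge2 l)
    have "of_nat (Suc (Suc l)) * fps_nth F (Suc (Suc l)) =
        complex_of_real (real (Suc (Suc l)) * gegenbauer lam (Suc (Suc l)) (Re u))"
      unfolding fps_gegenbauer_recursion(2)[OF ode] gegenbauer_Suc_Suc ge2[symmetric]
      by (simp add: t_def lc_def)
    then have "of_nat (Suc (Suc l)) * fps_nth F (Suc (Suc l)) =
        of_nat (Suc (Suc l)) * complex_of_real (gegenbauer lam (Suc (Suc l)) (Re u))"
      by simp
    then show ?case
      by (metis mult_left_cancel of_nat_eq_0_iff nat.distinct(1))
  qed
  then show ?thesis
    by (simp add: F_def fps_mult_nth nth_A atLeast0AtMost)
qed

lemma unit_complex_of_cos:
  assumes "t \<in> {-1..1::real}"
  obtains u :: complex where "norm u = 1" "Re u = t"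
  using assms by (intro that[of "cis (arccos t)"]) simp_all

text \<open>In the expansion over powers of u and \<open>cnj u\<close> all coefficients are
  nonnegative and |u| = 1, so the triangle inequality is attained at u = 1.\<close>

lemma gegenbauer_le_at_1:
  assumes "lam > 0" "t \<in> {-1..1}"
  shows "\<bar>gegenbauer lam l t\<bar> \<le> gegenbauer lam l 1"
proof -
  let ?b = "geometric_binomial lam"
  obtain u :: complex where u: "norm u = 1" "Re u = t"
    using unit_complex_of_cos[OF assms(2)] .
  have "complex_of_real (gegenbauer lam l 1) = complex_of_real (\<Sum>k\<le>l. ?b k * ?b (l - k))"
    using gegenbauer_complex[of 1 lam l] by simp
  then have one: "gegenbauer lam l 1 = (\<Sum>k\<le>l. ?b k * ?b (l - k))"
    unfolding of_real_eq_iff .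
  have "\<bar>gegenbauer lam l t\<bar> = norm (complex_of_real (gegenbauer lam l (Re u)))"
    by (simp add: u)
  also have "\<dots> \<le> (\<Sum>k\<le>l. norm ((of_real (?b k) * u ^ k) * (of_real (?b (l - k)) * cnj u ^ (l - k))))"
    unfolding gegenbauer_complex[OF u(1)] by (rule norm_sum)
  also have "\<dots> = gegenbauer lam l 1"
    unfolding one using u assms(1)
    by (simp add: norm_mult norm_power geometric_binomial_nonneg)
  finally show ?thesis .
qed

lemma norm_one_minus_square:
  assumes "norm u = 1"
  shows "(norm (1 - u * complex_of_real r))\<^sup>2 = 1 - 2 * Re u * r + r\<^sup>2"
proof -
  have "(Re u)\<^sup>2 + (Im u)\<^sup>2 = 1"
    using assms by (simp add: cmod_def)
  then have "r\<^sup>2 * ((Re u)\<^sup>2 + (Im u)\<^sup>2) = r\<^sup>2"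
    by simp
  then show ?thesis
    unfolding cmod_power2 by (simp add: power2_eq_square algebra_simps)
qed

lemma gegenbauer_generating_pos:
  assumes "t \<in> {-1..1}" "\<bar>r\<bar> < 1"
  shows "1 - 2 * t * r + r\<^sup>2 > (0::real)"
proof -
  have "\<bar>t * r\<bar> \<le> \<bar>r\<bar>"
    using assms by (auto simp: abs_mult intro!: mult_left_le_one_le)
  then have "1 - 2 * t * r + r\<^sup>2 \<ge> 1 - 2 * \<bar>r\<bar> + \<bar>r\<bar>\<^sup>2"
    by (simp add: abs_le_iff)
  moreover have "1 - 2 * \<bar>r\<bar> + \<bar>r\<bar>\<^sup>2 = (1 - \<bar>r\<bar>)\<^sup>2"
    by (simp add: power2_eq_square algebra_simps)
  ultimately show ?thesis
    using assms by (smt (verit) zero_less_power)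
qed

text \<open>Passage from the formal to the analytic generating function: the Cauchy product of two
  absolutely convergent conjugate binomial series, whose sums multiply to z * cnj z = |z|^2.\<close>

lemma gegenbauer_sums:
  assumes "t \<in> {-1..1}" "\<bar>r\<bar> < 1" "lam > 0"
  shows "(\<lambda>l. gegenbauer lam l t * r ^ l) sums (1 - 2 * t * r + r\<^sup>2) powr (- lam)"
proof -
  let ?b = "geometric_binomial lam"
  obtain u :: complex where u: "norm u = 1" "Re u = t"
    using unit_complex_of_cos[OF assms(1)] .
  define a where "a v k = of_real (?b k) * (v * of_real r) ^ k" for v :: complex and k
  have norm_summable: "summable (\<lambda>k. norm (a v k))" if "norm v = 1" for v
  proof -
    \<comment> \<open>The norms form the real binomial series at -|r|, which gives absolute
      convergence.\<close>
    have "((- lam) gchoose k) * (- \<bar>r\<bar>) ^ k = norm (a v k)" for k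
    proof -
      have "((- lam) gchoose k) * (- \<bar>r\<bar>) ^ k = ?b k * \<bar>r\<bar> ^ k"
        using gbinomial_minus_power[of lam k "of_real \<bar>r\<bar>"]
        by (simp flip: of_real_minus of_real_power of_real_mult of_real_eq_iff
              add: gbinomial_pochhammer geometric_binomial_def power_mult_distrib[symmetric])
      then show ?thesis
        using that geometric_binomial_nonneg[OF assms(3)]
        by (simp add: a_def norm_mult norm_power)
    qed
    then show ?thesis
      using gen_binomial_real[of "- \<bar>r\<bar>" "- lam"] assms(2) by (simp add: sums_iff)
  qed
  have sum_a: "suminf (a v) = (1 - v * of_real r) powr (- of_real lam)" if "norm v = 1" for v
  proof -
    have "(\<lambda>k. ((- of_real lam) gchoose k) * (- (v * of_real r)) ^ k) sums
        (1 + - (v * of_real r)) powr (- of_real lam)"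
      using assms(2) that by (intro gen_binomial_complex) (simp add: norm_mult)
    then show ?thesis
      unfolding gbinomial_minus_power by (simp add: a_def[abs_def] sums_iff)
  qed
  \<comment> \<open>Keeps the base off the open negative real axis, where conjugation would not
    commute with the principal power.\<close>
  have Re: "Re (1 - u * of_real r) \<ge> 0"
  proof -
    have "\<bar>t * r\<bar> \<le> 1"
      using assms by (auto simp: abs_mult intro!: mult_le_one)
    then show ?thesis by (simp add: u abs_le_iff)
  qed
  have "(\<lambda>l. \<Sum>k\<le>l. a u k * a (cnj u) (l - k)) sums (suminf (a u) * suminf (a (cnj u)))"
    using u by (intro Cauchy_product_sums norm_summable) simp_all
  moreover have "(\<Sum>k\<le>l. a u k * a (cnj u) (l - k)) = of_real (gegenbauer lam l t * r ^ l)" for l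
  proof -
    have "of_real (gegenbauer lam l t * r ^ l) =
        (\<Sum>k\<le>l. (of_real (?b k) * u ^ k) * (of_real (?b (l - k)) * cnj u ^ (l - k)) * of_real r ^ l)"
      using gegenbauer_complex[OF u(1), of lam l] by (simp add: u sum_distrib_right)
    also have "\<dots> = (\<Sum>k\<le>l. a u k * a (cnj u) (l - k))"
    proof (rule sum.cong[OF refl])
      fix k assume "k \<in> {..l}"
      then have "of_real r ^ l = (of_real r :: complex) ^ k * of_real r ^ (l - k)"
        by (simp flip: power_add)
      then show "(of_real (?b k) * u ^ k) * (of_real (?b (l - k)) * cnj u ^ (l - k)) * of_real r ^ l =
          a u k * a (cnj u) (l - k)"
        by (simp add: a_def power_mult_distrib mult_ac)
    qed
    finally show ?thesis ..
  qed
  moreover have "suminf (a u) * suminf (a (cnj u)) = of_real ((1 - 2 * t * r + r\<^sup>2) powr (- lam))"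
  proof -
    define z where "z = (1 - u * of_real r) powr (- complex_of_real lam)"
    have "cnj z = (1 - cnj u * of_real r) powr (- complex_of_real lam)"
      unfolding z_def using Re by (subst cnj_powr) simp_all
    then have "suminf (a u) * suminf (a (cnj u)) = z * cnj z"
      using u by (simp add: sum_a z_def)
    also have "\<dots> = of_real ((norm z)\<^sup>2)"
      by (rule complex_norm_square[symmetric])
    also have "norm z = norm (1 - u * of_real r) powr (- lam)"
      unfolding z_def by (subst norm_powr_real_powr') simp_all
    also have "\<dots>\<^sup>2 = ((norm (1 - u * of_real r))\<^sup>2) powr (- lam)"
      by (simp add: power2_eq_square powr_mult)
    finally show ?thesis
      unfolding norm_one_minus_square[OF u(1)] by (simp add: u)
  qed
  ultimately show ?thesis
    by (simp only: sums_of_real_iff)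
qed

definition poisson_term :: "real \<Rightarrow> real \<Rightarrow> real \<Rightarrow> nat \<Rightarrow> real" where
  "poisson_term lam t r l = r ^ l * ((lam + real l) / lam) * gegenbauer lam l t"

text \<open>Apply 1 + (r / lam) d/dr to the generating function: on the term of index l it
  multiplies by (lam + l) / lam, and on the closed form it produces the Poisson kernel.\<close>

lemma poisson_sums:
  assumes "t \<in> {-1..1}" "\<bar>r\<bar> < 1" "lam > 0"
  shows "poisson_term lam t r sums
    ((1 - r\<^sup>2) * (1 - 2 * t * r + r\<^sup>2) powr (- lam - 1))"
proof -
  let ?c = "\<lambda>l. gegenbauer lam l t" and ?g = "\<lambda>r. 1 - 2 * t * r + r\<^sup>2"
  have sm: "summable (\<lambda>l. ?c l * x ^ l)" if "norm x < 1" for x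
    using gegenbauer_sums[OF assms(1) _ assms(3), of x] that by (simp add: sums_iff)
  have "((\<lambda>x. \<Sum>l. ?c l * x ^ l) has_real_derivative (\<Sum>l. diffs ?c l * r ^ l)) (at r)"
    using assms(2) by (intro termdiffs_strong'[of 1] sm) simp_all
  moreover have "(\<Sum>l. ?c l * x ^ l) = ?g x powr (- lam)" if "x \<in> ball 0 1" for x
    using gegenbauer_sums[OF assms(1) _ assms(3), of x] that by (simp add: sums_iff)
  ultimately have "((\<lambda>x. ?g x powr (- lam)) has_real_derivative (\<Sum>l. diffs ?c l * r ^ l)) (at r)"
    using assms(2) by (elim has_field_derivative_transform_within_open[where S = "ball 0 1"]) simp_all
  moreover have "((\<lambda>x. ?g x powr (- lam)) has_real_derivative
      - lam * ?g r powr (- lam - 1) * (2 * r - 2 * t)) (at r)"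
  proof -
    have "(?g has_real_derivative 2 * r - 2 * t) (at r)"
      by (auto intro!: derivative_eq_intros)
    from DERIV_chain2[OF has_real_derivative_powr[OF gegenbauer_generating_pos[OF assms(1,2)]] this]
    show ?thesis .
  qed
  ultimately have sum_diffs: "(\<Sum>l. diffs ?c l * r ^ l) =
      - lam * ?g r powr (- lam - 1) * (2 * r - 2 * t)"
    by (rule DERIV_unique)
  have "summable (\<lambda>l. diffs ?c l * r ^ l)"
    using assms(2) by (intro termdiff_converges[of r 1] sm) simp_all
  then have "(\<lambda>l. r * (diffs ?c l * r ^ l)) sums
      (r * (- lam * ?g r powr (- lam - 1) * (2 * r - 2 * t)))"
    unfolding sum_diffs[symmetric] by (intro sums_mult summable_sums)
  then have "(\<lambda>l. real (Suc l) * ?c (Suc l) * r ^ Suc l) sums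
      (r * (- lam * ?g r powr (- lam - 1) * (2 * r - 2 * t)))"
    by (simp add: diffs_def mult_ac)
  \<comment> \<open>The shift of the index costs nothing, since the term for l = 0 is zero.\<close>
  then have "(\<lambda>l. real l * ?c l * r ^ l) sums (r * (- lam * ?g r powr (- lam - 1) * (2 * r - 2 * t)))"
    by (subst (asm) sums_Suc_iff) simp
  from sums_add[OF gegenbauer_sums[OF assms] sums_mult[OF this, of "1 / lam"]]
  have "(\<lambda>l. ?c l * r ^ l + 1 / lam * (real l * ?c l * r ^ l)) sums
      (?g r powr (- lam) + 1 / lam * (r * (- lam * ?g r powr (- lam - 1) * (2 * r - 2 * t))))" .
  moreover have "?c l * r ^ l + 1 / lam * (real l * ?c l * r ^ l) = poisson_term lam t r l" for l
    using assms(3) by (simp add: poisson_term_def field_simps)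
  moreover have "?g r powr (- lam) + 1 / lam * (r * (- lam * ?g r powr (- lam - 1) * (2 * r - 2 * t))) =
      (1 - r\<^sup>2) * ?g r powr (- lam - 1)"
  proof -
    have "?g r powr (- lam) = ?g r * ?g r powr (- lam - 1)"
      using gegenbauer_generating_pos[OF assms(1,2)] powr_add[of "?g r" 1 "- lam - 1"] by simp
    then have "?g r powr (- lam) + 1 / lam * (r * (- lam * ?g r powr (- lam - 1) * (2 * r - 2 * t))) =
        (?g r - r * (2 * r - 2 * t)) * ?g r powr (- lam - 1)"
      using assms(3) by (simp add: algebra_simps)
    also have "?g r - r * (2 * r - 2 * t) = 1 - r\<^sup>2"
      by (simp add: power2_eq_square algebra_simps)
    finally show ?thesis .
  qed
  ultimately show ?thesis by simp
qed

lemma poisson_nonneg: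
  assumes "t \<in> {-1..1}" "\<bar>r\<bar> < 1" "lam > 0"
  shows "suminf (poisson_term lam t r) \<ge> 0"
  using poisson_sums[OF assms] assms(2) by (simp add: sums_iff abs_square_le_1)

lemma poisson_term_bound:
  assumes "t \<in> {-1..1}" "0 \<le> r" "lam > 0"
  shows "\<bar>poisson_term lam t r l\<bar> \<le> poisson_term lam 1 r l"
  using assms gegenbauer_le_at_1[OF assms(3,1), of l]
  by (auto simp: poisson_term_def abs_mult intro!: mult_left_mono divide_right_mono)

lemma poisson_term_at_1_nonneg: "lam > 0 \<Longrightarrow> 0 \<le> r \<Longrightarrow> poisson_term lam 1 r l \<ge> 0"
  using poisson_term_bound[of 1 r lam l] by simp

lemma summable_poisson_at_1: "0 \<le> r \<Longrightarrow> r < 1 \<Longrightarrow> lam > 0 \<Longrightarrow> summable (poisson_term lam 1 r)"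
  using poisson_sums[of 1 r lam] by (simp add: sums_iff)

section \<open>The surface measure in the first coordinate\<close>

lemma sin_arctan_strict_mono: "x < y \<Longrightarrow> sin (arctan x) < sin (arctan y)"
  using arctan_bounded[of x] arctan_bounded[of y]
  by (intro sin_monotone_2pi) (auto simp: arctan_less_iff)

lemma tan_arcsin_eq: "t \<in> {-1<..<1} \<Longrightarrow> tan (arcsin t) = t / sqrt (1 - t\<^sup>2)"
  by (simp add: tan_def cos_arcsin)

lemma sin_arctan_tan_arcsin:
  assumes "t \<in> {-1<..<1}"
  shows "sin (arctan (tan (arcsin t))) = t"
  using assms arcsin_lt_bounded[of t] by (simp add: arctan_tan)

lemma sin_arctan_in_interval: "sin (arctan x) \<in> {-1<..<1}"
proof -
  have "\<bar>x\<bar> < sqrt (1 + x\<^sup>2)"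
    by (rule real_less_rsqrt) simp
  then show ?thesis
    by (simp add: sin_arctan field_simps abs_less_iff add_pos_nonneg)
qed

lemma tan_arcsin_sin_arctan: "tan (arcsin (sin (arctan x))) = x"
  using arctan_bounded[of x] by (simp add: arcsin_sin tan_arctan)

lemma tan_arcsin_has_derivative:
  assumes "t \<in> {-1<..<1}"
  shows "((\<lambda>t. tan (arcsin t)) has_real_derivative (1 - t\<^sup>2) powr (- 3/2)) (at t)"
proof -
  have pos: "1 - t\<^sup>2 > 0"
    using square_less_1_real[OF assms] by simp
  have "cos (arcsin t) = sqrt (1 - t\<^sup>2)"
    using assms by (simp add: cos_arcsin)
  then have "((\<lambda>t. tan (arcsin t)) has_real_derivative
      inverse ((sqrt (1 - t\<^sup>2))\<^sup>2) * inverse (sqrt (1 - t\<^sup>2))) (at t)"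
    using DERIV_chain2[OF DERIV_tan DERIV_arcsin, of t] assms pos by simp
  moreover have "inverse ((sqrt (1 - t\<^sup>2))\<^sup>2) * inverse (sqrt (1 - t\<^sup>2)) = (1 - t\<^sup>2) powr (- 3/2)"
  proof -
    have "(sqrt (1 - t\<^sup>2))\<^sup>2 = 1 - t\<^sup>2"
      using pos by simp
    then show ?thesis
      using pos powr_add[of "1 - t\<^sup>2" "-1" "-1/2"]
      by (simp add: powr_half_sqrt[symmetric] powr_minus inverse_eq_divide)
  qed
  ultimately show ?thesis by simp
qed

text \<open>Change of variables stated as an equality of measures and checked on intervals by the
  fundamental theorem of calculus. In this form it applies to every nonnegative Borel function, with
  no integrability condition.\<close>

lemma lborel_eq_distr_tan_arcsin:
  "lborel = distr (density lborel (\<lambda>t. ennreal ((1 - t\<^sup>2) powr (- 3/2)) * indicator {-1<..<1} t)) borel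
    (\<lambda>t. t / sqrt (1 - t\<^sup>2))" (is "_ = ?M")
proof (rule lborel_eqI)
  fix l u :: real
  assume "\<And>b. b \<in> Basis \<Longrightarrow> l \<bullet> b \<le> u \<bullet> b"
  then have "l \<le> u" by simp
  define a b where "a = sin (arctan l)" and "b = sin (arctan u)"
  have ab: "a \<in> {-1<..<1}" "b \<in> {-1<..<1}"
    unfolding a_def b_def by (rule sin_arctan_in_interval)+
  have "a \<le> b"
    using sin_arctan_strict_mono[of l u] \<open>l \<le> u\<close> unfolding a_def b_def
    by (cases "l = u") auto
  have less_iff: "sin (arctan x) < sin (arctan y) \<longleftrightarrow> x < y" for x y
    using sin_arctan_strict_mono by (metis less_irrefl less_trans linorder_neqE)
  have box: "t / sqrt (1 - t\<^sup>2) \<in> {l<..<u} \<longleftrightarrow> t \<in> {a<..<b}" if "t \<in> {-1<..<1}" for t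
  proof -
    have *: "sin (arctan (t / sqrt (1 - t\<^sup>2))) = t"
      using sin_arctan_tan_arcsin[OF that] tan_arcsin_eq[OF that] by simp
    show ?thesis
      using less_iff[of l "t / sqrt (1 - t\<^sup>2)"] less_iff[of "t / sqrt (1 - t\<^sup>2)" u]
      unfolding * a_def b_def by simp
  qed
  have "emeasure ?M (box l u) = (\<integral>\<^sup>+t. (ennreal ((1 - t\<^sup>2) powr (- 3/2)) * indicator {-1<..<1} t)
      * indicator ((\<lambda>t. t / sqrt (1 - t\<^sup>2)) -` box l u) t \<partial>lborel)"
  proof -
    have "(\<lambda>t. t / sqrt (1 - t\<^sup>2)) -` box l u \<in> sets borel"
      by (rule measurable_sets_borel[of _ borel]) measurable
    then show ?thesis
      by (subst emeasure_distr) (auto simp: emeasure_density)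
  qed
  also have "\<dots> = (\<integral>\<^sup>+t. ennreal ((1 - t\<^sup>2) powr (- 3/2)) * indicator {a..b} t \<partial>lborel)"
  proof (rule nn_integral_cong_AE)
    have "AE t in lborel. t \<noteq> a \<and> t \<noteq> b"
      using AE_lborel_singleton[of a] AE_lborel_singleton[of b] by eventually_elim auto
    then show "AE t in lborel. (ennreal ((1 - t\<^sup>2) powr (- 3/2)) * indicator {-1<..<1} t)
        * indicator ((\<lambda>t. t / sqrt (1 - t\<^sup>2)) -` box l u) t =
        ennreal ((1 - t\<^sup>2) powr (- 3/2)) * indicator {a..b} t"
    proof eventually_elim
      case (elim t)
      show ?case
      proof (cases "t \<in> {-1<..<1}")
        case True
        then show ?thesis
          using box[OF True] elim by (auto simp: box_real indicator_def)
      next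
        case False
        then show ?thesis
          using ab by (auto simp: indicator_def)
      qed
    qed
  qed
  also have "\<dots> = ennreal (tan (arcsin b) - tan (arcsin a))"
    using ab \<open>a \<le> b\<close> by (intro nn_integral_FTC_Icc tan_arcsin_has_derivative) auto
  also have "\<dots> = ennreal (u - l)"
    unfolding a_def b_def tan_arcsin_sin_arctan ..
  finally show "emeasure ?M (box l u) = ennreal (\<Prod>b\<in>Basis. (u - l) \<bullet> b)"
    by simp
qed simp

lemma nn_integral_substitution_tan_arcsin:
  assumes [measurable]: "g \<in> borel_measurable borel"
  shows "(\<integral>\<^sup>+s. g s \<partial>lborel) =
    (\<integral>\<^sup>+t. ennreal ((1 - t\<^sup>2) powr (- 3/2)) * indicator {-1<..<1} t * g (t / sqrt (1 - t\<^sup>2)) \<partial>lborel)"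
  by (subst lborel_eq_distr_tan_arcsin, subst nn_integral_distr) (simp_all add: nn_integral_density)

section \<open>The cone measure sliced along the first coordinate\<close>

abbreviation lborel_on :: "nat set \<Rightarrow> (nat \<Rightarrow> real) measure" where
  "lborel_on I \<equiv> \<Pi>\<^sub>M i\<in>I. lborel"

lemma emeasure_L2_set_le:
  assumes "finite I" "r > 0"
  shows "emeasure (lborel_on I) {y \<in> space (lborel_on I). L2_set y I \<le> r} =
    ennreal (unit_ball_vol (real (card I)) * r ^ card I)"
  using emeasure_cball_aux[OF assms] by (simp add: L2_set_def Int_def conj_commute)

lemma L2_set_measurable [measurable]:
  assumes "finite I"
  shows "(\<lambda>y. L2_set y I) \<in> borel_measurable (lborel_on I)"
  unfolding L2_set_def by measurable

lemma AE_L2_set_pos: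
  assumes "finite I" "I \<noteq> {}"
  shows "AE y in lborel_on I. L2_set y I > 0"
proof -
  interpret product_sigma_finite "\<lambda>_::nat. lborel :: real measure" ..
  have z: "{\<lambda>i\<in>I. 0} = (\<Pi>\<^sub>E i\<in>I. {0::real})"
    by (auto simp: PiE_def extensional_def fun_eq_iff)
  have "emeasure (lborel_on I) {\<lambda>i\<in>I. 0} = 0"
    unfolding z using assms by (subst emeasure_PiM) (auto simp: card_gt_0_iff)
  moreover have "{\<lambda>i\<in>I. 0} \<in> sets (lborel_on I)"
    unfolding z using assms by (intro sets_PiM_I_finite) auto
  ultimately have "{\<lambda>i\<in>I. 0} \<in> null_sets (lborel_on I)"
    by (rule null_setsI)
  then show ?thesis
  proof (rule AE_I')
    show "{y \<in> space (lborel_on I). \<not> L2_set y I > 0} \<subseteq> {\<lambda>i\<in>I. 0}"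
    proof (rule subsetI)
      fix y assume y: "y \<in> {y \<in> space (lborel_on I). \<not> L2_set y I > 0}"
      then have "L2_set y I = 0"
        using L2_set_nonneg[of y I] by simp
      then have "\<And>i. i \<in> I \<Longrightarrow> y i = 0"
        using L2_set_eq_0_iff[OF assms(1)] by blast
      with y show "y \<in> {\<lambda>i\<in>I. 0}"
        by (auto simp: space_PiM PiE_def extensional_def fun_eq_iff)
    qed
  qed
qed

text \<open>Layer cake: \<open>L2_set y I\<close> is the integral of \<open>1\<close> over \<open>0 \<le> u < L2_set y I\<close>.\<close>

lemma nn_integral_L2_set_ball:
  assumes "finite I" "c > 0"
  defines "m \<equiv> card I"
  shows "(\<integral>\<^sup>+y. ennreal (L2_set y I) * indicator {y. L2_set y I \<le> c} y \<partial>lborel_on I) =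
    ennreal (unit_ball_vol (real m) * (real m / real (Suc m)) * c ^ Suc m)"
proof -
  let ?Q = "lborel_on I" and ?v = "unit_ball_vol (real m)"
  define F where "F u = ?v * (c ^ m * u - u ^ Suc m / real (Suc m))" for u
  interpret product_sigma_finite "\<lambda>_::nat. lborel :: real measure" ..
  interpret Q: sigma_finite_measure ?Q
    by (rule sigma_finite[OF assms(1)])
  interpret pair_sigma_finite ?Q lborel ..
  have [measurable]: "(\<lambda>y. L2_set y I) \<in> borel_measurable ?Q"
    by (rule L2_set_measurable[OF assms(1)])
  have "(\<integral>\<^sup>+y. ennreal (L2_set y I) * indicator {y. L2_set y I \<le> c} y \<partial>?Q) =
      (\<integral>\<^sup>+y. (\<integral>\<^sup>+u. (if 0 < u \<and> u < L2_set y I \<and> L2_set y I \<le> c then 1 else 0) \<partial>lborel) \<partial>?Q)"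
  proof (intro nn_integral_cong)
    fix y
    have "(\<integral>\<^sup>+u. (if 0 < u \<and> u < L2_set y I \<and> L2_set y I \<le> c then 1 else 0) \<partial>lborel) =
        (\<integral>\<^sup>+u. indicator {0<..<L2_set y I} u * indicator {y. L2_set y I \<le> c} y \<partial>lborel)"
      by (intro nn_integral_cong) (auto simp: indicator_def)
    also have "\<dots> = ennreal (L2_set y I) * indicator {y. L2_set y I \<le> c} y"
      by (subst nn_integral_multc) (simp_all add: L2_set_nonneg)
    finally show "ennreal (L2_set y I) * indicator {y. L2_set y I \<le> c} y =
        (\<integral>\<^sup>+u. (if 0 < u \<and> u < L2_set y I \<and> L2_set y I \<le> c then 1 else 0) \<partial>lborel)" ..
  qed
  also have "\<dots> = (\<integral>\<^sup>+u. (\<integral>\<^sup>+y. (if 0 < u \<and> u < L2_set y I \<and> L2_set y I \<le> c then 1 else 0) \<partial>?Q) \<partial>lborel)"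
    by (rule Fubini'[symmetric]) measurable
  \<comment> \<open>For fixed u the inner integral is the volume of the shell of all y with u < |y|
    <= c.\<close>
  also have "\<dots> = (\<integral>\<^sup>+u. ennreal (?v * (c ^ m - u ^ m)) * indicator {0..c} u \<partial>lborel)"
  proof (intro nn_integral_cong_AE)
    show "AE u in lborel. (\<integral>\<^sup>+y. (if 0 < u \<and> u < L2_set y I \<and> L2_set y I \<le> c then 1 else 0) \<partial>?Q) =
        ennreal (?v * (c ^ m - u ^ m)) * indicator {0..c} u"
      using AE_lborel_singleton[of 0]
    proof eventually_elim
      case (elim u)
      show ?case
      proof (cases "0 < u \<and> u \<le> c")
        case True
        let ?B = "\<lambda>r. {y \<in> space ?Q. L2_set y I \<le> r}"
        have "(\<integral>\<^sup>+y. (if 0 < u \<and> u < L2_set y I \<and> L2_set y I \<le> c then 1 else 0) \<partial>?Q) =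
            (\<integral>\<^sup>+y. indicator (?B c - ?B u) y \<partial>?Q)"
          using True by (intro nn_integral_cong) (auto simp: indicator_def)
        also have "\<dots> = emeasure ?Q (?B c - ?B u)"
          by (intro nn_integral_indicator) measurable
        also have "\<dots> = emeasure ?Q (?B c) - emeasure ?Q (?B u)"
          using True emeasure_L2_set_le[OF assms(1), of u] by (intro emeasure_Diff) auto
        also have "\<dots> = ennreal (?v * c ^ m - ?v * u ^ m)"
          using True assms by (simp add: emeasure_L2_set_le m_def ennreal_minus)
        also have "\<dots> = ennreal (?v * (c ^ m - u ^ m)) * indicator {0..c} u"
          using True by (simp add: right_diff_distrib)
        finally show ?thesis .
      next
        case False
        then have "u \<notin> {0..c}"
          and z: "(if 0 < u \<and> u < L2_set y I \<and> L2_set y I \<le> c then 1 else 0) = (0 :: ennreal)" for y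
          using elim by auto
        then show ?thesis unfolding z by simp
      qed
    qed
  qed
  also have "\<dots> = ennreal (F c - F 0)"
  proof (rule nn_integral_FTC_Icc)
    show "(F has_real_derivative ?v * (c ^ m - x ^ m)) (at x)" for x
      unfolding F_def by (auto intro!: derivative_eq_intros simp del: power_Suc)
    show "0 \<le> ?v * (c ^ m - x ^ m)" if "x \<in> {0..c}" for x
      using that by (simp add: power_mono)
  qed (use assms in auto)
  also have "F c - F 0 = ?v * (real m / real (Suc m)) * c ^ Suc m"
    by (simp add: F_def field_simps)
  finally show ?thesis .
qed

text \<open>Here \<rho> is the norm of the other coordinates. Replacing s by \<rho> s makes the
  normalized first coordinate independent of \<rho>, so the integral over those coordinates later
  reduces to a moment of a ball.\<close>

lemma nn_integral_line_through_ball: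
  assumes [measurable]: "f \<in> borel_measurable borel" and "\<rho> > 0"
  shows "(\<integral>\<^sup>+s. f (s / sqrt (s\<^sup>2 + \<rho>\<^sup>2)) * indicator {s. sqrt (s\<^sup>2 + \<rho>\<^sup>2) \<le> 1} s \<partial>lborel) =
    (\<integral>\<^sup>+s. f (s / sqrt (1 + s\<^sup>2)) * (ennreal \<rho> * indicator {\<rho>. \<rho> \<le> 1 / sqrt (1 + s\<^sup>2)} \<rho>) \<partial>lborel)"
proof -
  have scale: "sqrt ((\<rho> * s)\<^sup>2 + \<rho>\<^sup>2) = \<rho> * sqrt (1 + s\<^sup>2)" for s
  proof -
    have "(\<rho> * s)\<^sup>2 + \<rho>\<^sup>2 = \<rho>\<^sup>2 * (1 + s\<^sup>2)"
      by (simp add: power2_eq_square algebra_simps)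
    then show ?thesis
      using assms(2) by (simp add: real_sqrt_mult)
  qed
  have pos: "sqrt (1 + s\<^sup>2) > 0" for s :: real
    by (simp add: add_pos_nonneg)
  have "(\<integral>\<^sup>+s. f (s / sqrt (s\<^sup>2 + \<rho>\<^sup>2)) * indicator {s. sqrt (s\<^sup>2 + \<rho>\<^sup>2) \<le> 1} s \<partial>lborel) =
      ennreal \<rho> * (\<integral>\<^sup>+s. f (\<rho> * s / sqrt ((\<rho> * s)\<^sup>2 + \<rho>\<^sup>2))
        * indicator {s. sqrt (s\<^sup>2 + \<rho>\<^sup>2) \<le> 1} (\<rho> * s) \<partial>lborel)"
    using assms(2) by (subst nn_integral_real_affine[of _ \<rho> 0]) auto
  also have "\<dots> = (\<integral>\<^sup>+s. ennreal \<rho> * (f (\<rho> * s / sqrt ((\<rho> * s)\<^sup>2 + \<rho>\<^sup>2))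
        * indicator {s. sqrt (s\<^sup>2 + \<rho>\<^sup>2) \<le> 1} (\<rho> * s)) \<partial>lborel)"
    by (rule nn_integral_cmult[symmetric]) measurable
  also have "\<dots> = (\<integral>\<^sup>+s. f (s / sqrt (1 + s\<^sup>2)) *
      (ennreal \<rho> * indicator {\<rho>. \<rho> \<le> 1 / sqrt (1 + s\<^sup>2)} \<rho>) \<partial>lborel)"
  proof (intro nn_integral_cong)
    fix s
    have "\<rho> * s / (\<rho> * sqrt (1 + s\<^sup>2)) = s / sqrt (1 + s\<^sup>2)"
      using assms(2) by simp
    moreover have "indicator {s. sqrt (s\<^sup>2 + \<rho>\<^sup>2) \<le> 1} (\<rho> * s) =
        (indicator {\<rho>. \<rho> \<le> 1 / sqrt (1 + s\<^sup>2)} \<rho> :: ennreal)"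
      using pos[of s] unfolding indicator_def mem_Collect_eq scale by (simp add: le_divide_eq)
    ultimately show "ennreal \<rho> * (f (\<rho> * s / sqrt ((\<rho> * s)\<^sup>2 + \<rho>\<^sup>2))
        * indicator {s. sqrt (s\<^sup>2 + \<rho>\<^sup>2) \<le> 1} (\<rho> * s)) =
        f (s / sqrt (1 + s\<^sup>2)) * (ennreal \<rho> * indicator {\<rho>. \<rho> \<le> 1 / sqrt (1 + s\<^sup>2)} \<rho>)"
      by (simp only: scale mult_ac)
  qed
  finally show ?thesis .
qed

text \<open>The exponent is -3/2 from the change of variables plus (n + 1) / 2 from the ball radius
  1 / sqrt (1 + s^2) = sqrt (1 - t^2), which adds up to lam - 1/2.\<close>

lemma sphere_substitution_weight:
  assumes "t \<in> {-1<..<1}"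
  defines "s \<equiv> t / sqrt (1 - t\<^sup>2)"
  shows "s / sqrt (1 + s\<^sup>2) = t"
    and "(1 - t\<^sup>2) powr (- 3/2) * (1 / sqrt (1 + s\<^sup>2)) ^ Suc n = (1 - t\<^sup>2) powr ((real n - 1) / 2 - 1/2)"
proof -
  have pos: "1 - t\<^sup>2 > 0"
    using square_less_1_real[OF assms(1)] by simp
  have "1 + s\<^sup>2 = 1 / (1 - t\<^sup>2)"
    using pos by (simp add: s_def power_divide field_simps)
  then have r: "sqrt (1 + s\<^sup>2) = 1 / sqrt (1 - t\<^sup>2)"
    by (simp add: real_sqrt_divide)
  show "s / sqrt (1 + s\<^sup>2) = t"
    using pos unfolding r by (simp add: s_def)
  have "sqrt (1 - t\<^sup>2) ^ Suc n = (1 - t\<^sup>2) powr (1/2 * real (Suc n))"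
    using pos by (simp only: powr_half_sqrt[symmetric] powr_powr[symmetric] powr_realpow powr_gt_zero)
  moreover have "(real n - 1) / 2 - 1/2 = - 3/2 + 1/2 * real (Suc n)"
    by (simp add: field_simps)
  ultimately show "(1 - t\<^sup>2) powr (- 3/2) * (1 / sqrt (1 + s\<^sup>2)) ^ Suc n =
      (1 - t\<^sup>2) powr ((real n - 1) / 2 - 1/2)"
    using pos unfolding r by (simp only: powr_add) simp
qed

text \<open>A point of the cone is split into its first coordinate and a vector y of the remaining n
  coordinates. Scaling by |y| decouples the two, the integral of |y| over a ball supplies a power of
  the radius, and the slope s is exchanged for t.\<close>

lemma nn_integral_sphere_measure:
  assumes [measurable]: "f \<in> borel_measurable borel" and n: "n \<ge> 1"
  shows "(\<integral>\<^sup>+x. f (x 0) \<partial>sphere_measure n) =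
    ennreal (real n * unit_ball_vol (real n)) * (\<integral>\<^sup>+t. f t \<partial>gegenbauer_measure ((real n - 1) / 2))"
proof -
  let ?Q = "lborel_on {1..n}"
  define \<rho> where "\<rho> y = L2_set y {1..n}" for y :: "nat \<Rightarrow> real"
  \<comment> \<open>The integral of |y| over the unit ball of dimension n. Its denominator n + 1
    cancels the factor n + 1 in the definition of the surface measure.\<close>
  define k where "k = unit_ball_vol (real n) * (real n / real (Suc n))"
  interpret product_sigma_finite "\<lambda>_::nat. lborel :: real measure" ..
  interpret Q: sigma_finite_measure ?Q
    by (rule sigma_finite) simp
  interpret pair_sigma_finite ?Q lborel ..
  have [measurable]: "\<rho> \<in> borel_measurable ?Q"
    unfolding \<rho>_def by (rule L2_set_measurable) simp
  have [measurable]: "(\<lambda>x. L2_set x {..n}) \<in> borel_measurable (lborel_on {..n})"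
    by (rule L2_set_measurable) simp
  have insert: "{..n} = insert 0 {1..n}"
    by auto
  have k: "k \<ge> 0"
    by (simp add: k_def)
  have upd: "L2_set (y(0 := s)) {..n} = sqrt (s\<^sup>2 + (\<rho> y)\<^sup>2)" for y s
  proof -
    have "L2_set (y(0 := s)) {1..n} = \<rho> y"
      unfolding \<rho>_def by (rule L2_set_cong) auto
    then show ?thesis
      by (simp add: insert)
  qed
  have f_meas [measurable]: "(\<lambda>x. f (x 0)) \<in> borel_measurable (restrict_space (\<Pi>\<^sub>M i\<in>{..n}. borel) (unit_sphere n))"
    by (rule measurable_restrict_space1) measurable
  have "(\<integral>\<^sup>+x. f (x 0) \<partial>sphere_measure n) = of_nat (Suc n) *
      (\<integral>\<^sup>+x. f (radial_projection n x 0) \<partial>restrict_space (lborel_on {..n}) (punctured_ball n))"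
    unfolding sphere_measure_def
    by (subst nn_integral_scale_measure) (simp_all add: nn_integral_distr[OF radial_projection_measurable])
  also have "(\<integral>\<^sup>+x. f (radial_projection n x 0) \<partial>restrict_space (lborel_on {..n}) (punctured_ball n)) =
      (\<integral>\<^sup>+x. f (x 0 / L2_set x {..n}) * indicator (punctured_ball n) x \<partial>lborel_on {..n})"
    using punctured_ball_sets[of n]
    by (subst nn_integral_restrict_space) (auto simp: radial_projection_def)
  also have "\<dots> = (\<integral>\<^sup>+y. (\<integral>\<^sup>+s. f (s / L2_set (y(0 := s)) {..n}) *
      indicator (punctured_ball n) (y(0 := s)) \<partial>lborel) \<partial>?Q)"
  proof -
    have "(\<lambda>x. f (x 0 / L2_set x {..n}) * indicator (punctured_ball n) x) \<in> borel_measurable (lborel_on {..n})"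
      using punctured_ball_sets[of n] by measurable
    then show ?thesis
      using product_nn_integral_insert[of "{1..n}" 0
          "\<lambda>x. f (x 0 / L2_set x {..n}) * indicator (punctured_ball n) x"]
      unfolding insert[symmetric] by simp
  qed
  also have "\<dots> = (\<integral>\<^sup>+y. (\<integral>\<^sup>+s. f (s / sqrt (1 + s\<^sup>2)) *
      (ennreal (\<rho> y) * indicator {y. \<rho> y \<le> 1 / sqrt (1 + s\<^sup>2)} y) \<partial>lborel) \<partial>?Q)"
  proof (intro nn_integral_cong_AE)
    have "AE y in ?Q. \<rho> y > 0"
      unfolding \<rho>_def by (rule AE_L2_set_pos) (use n in auto)
    moreover have "AE y in ?Q. y \<in> space ?Q"
      by (rule AE_space)
    ultimately show "AE y in ?Q. (\<integral>\<^sup>+s. f (s / L2_set (y(0 := s)) {..n}) *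
        indicator (punctured_ball n) (y(0 := s)) \<partial>lborel) =
        (\<integral>\<^sup>+s. f (s / sqrt (1 + s\<^sup>2)) *
          (ennreal (\<rho> y) * indicator {y. \<rho> y \<le> 1 / sqrt (1 + s\<^sup>2)} y) \<partial>lborel)"
    proof eventually_elim
      case (elim y)
      have "y(0 := s) \<in> punctured_ball n \<longleftrightarrow> sqrt (s\<^sup>2 + (\<rho> y)\<^sup>2) \<le> 1" for s
      proof -
        have "y(0 := s) \<in> {..n} \<rightarrow>\<^sub>E UNIV"
          using elim(2) unfolding insert by (auto simp: space_PiM PiE_def extensional_def)
        moreover have "sqrt (s\<^sup>2 + (\<rho> y)\<^sup>2) > 0"
          using elim(1) by (simp add: add_nonneg_pos)
        ultimately show ?thesis
          by (simp add: punctured_ball_def upd)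
      qed
      then have "(\<integral>\<^sup>+s. f (s / L2_set (y(0 := s)) {..n}) *
          indicator (punctured_ball n) (y(0 := s)) \<partial>lborel) =
          (\<integral>\<^sup>+s. f (s / sqrt (s\<^sup>2 + (\<rho> y)\<^sup>2)) * indicator {s. sqrt (s\<^sup>2 + (\<rho> y)\<^sup>2) \<le> 1} s \<partial>lborel)"
        unfolding upd by (simp add: indicator_def)
      then show ?case
        unfolding nn_integral_line_through_ball[OF assms(1) elim(1)] by (simp add: indicator_def)
    qed
  qed
  also have "\<dots> = (\<integral>\<^sup>+s. (\<integral>\<^sup>+y. f (s / sqrt (1 + s\<^sup>2)) *
      (ennreal (\<rho> y) * indicator {y. \<rho> y \<le> 1 / sqrt (1 + s\<^sup>2)} y) \<partial>?Q) \<partial>lborel)"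
    unfolding indicator_def by (rule Fubini'[symmetric]) measurable
  also have "\<dots> = (\<integral>\<^sup>+s. f (s / sqrt (1 + s\<^sup>2)) * ennreal (k * (1 / sqrt (1 + s\<^sup>2)) ^ Suc n) \<partial>lborel)"
  proof (intro nn_integral_cong)
    fix s :: real
    have "1 / sqrt (1 + s\<^sup>2) > 0"
      by (simp add: add_pos_nonneg)
    then have "(\<integral>\<^sup>+y. ennreal (\<rho> y) * indicator {y. \<rho> y \<le> 1 / sqrt (1 + s\<^sup>2)} y \<partial>?Q) =
        ennreal (k * (1 / sqrt (1 + s\<^sup>2)) ^ Suc n)"
      unfolding \<rho>_def k_def by (subst nn_integral_L2_set_ball) (simp_all del: power_Suc)
    moreover have "(\<integral>\<^sup>+y. f (s / sqrt (1 + s\<^sup>2)) * (ennreal (\<rho> y) * indicator {y. \<rho> y \<le> 1 / sqrt (1 + s\<^sup>2)} y) \<partial>?Q) =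
        f (s / sqrt (1 + s\<^sup>2)) * (\<integral>\<^sup>+y. ennreal (\<rho> y) * indicator {y. \<rho> y \<le> 1 / sqrt (1 + s\<^sup>2)} y \<partial>?Q)"
      unfolding indicator_def by (intro nn_integral_cmult) measurable
    ultimately show "(\<integral>\<^sup>+y. f (s / sqrt (1 + s\<^sup>2)) * (ennreal (\<rho> y) * indicator {y. \<rho> y \<le> 1 / sqrt (1 + s\<^sup>2)} y) \<partial>?Q) =
        f (s / sqrt (1 + s\<^sup>2)) * ennreal (k * (1 / sqrt (1 + s\<^sup>2)) ^ Suc n)"
      by simp
  qed
  also have "\<dots> = (\<integral>\<^sup>+t. ennreal k * (ennreal (indicator {-1..1} t * (1 - t\<^sup>2) powr ((real n - 1) / 2 - 1/2)) * f t) \<partial>lborel)"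
  proof (subst nn_integral_substitution_tan_arcsin, measurable, intro nn_integral_cong)
    fix t :: real
    show "ennreal ((1 - t\<^sup>2) powr (- 3/2)) * indicator {-1<..<1} t *
        (f (t / sqrt (1 - t\<^sup>2) / sqrt (1 + (t / sqrt (1 - t\<^sup>2))\<^sup>2)) *
          ennreal (k * (1 / sqrt (1 + (t / sqrt (1 - t\<^sup>2))\<^sup>2)) ^ Suc n)) =
        ennreal k * (ennreal (indicator {-1..1} t * (1 - t\<^sup>2) powr ((real n - 1) / 2 - 1/2)) * f t)"
    proof (cases "t \<in> {-1<..<1}")
      case True
      show ?thesis
        unfolding sphere_substitution_weight(1)[OF True] sphere_substitution_weight(2)[OF True, symmetric]
        using True k by (simp add: ennreal_mult mult_ac del: power_Suc)
    next
      case False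
      \<comment> \<open>At t = 1 and t = -1 the closed indicator is 1, but there
        \<open>0 powr x = 0\<close>.\<close>
      then have z: "indicator {-1..1} t * (1 - t\<^sup>2) powr ((real n - 1) / 2 - 1/2) = 0"
        by (cases "t = 1 \<or> t = -1") (auto simp: indicator_def)
      show ?thesis using False unfolding z by simp
    qed
  qed
  also have "\<dots> = ennreal k * (\<integral>\<^sup>+t. f t \<partial>gegenbauer_measure ((real n - 1) / 2))"
    unfolding gegenbauer_measure_def
    by (subst nn_integral_cmult) (simp_all add: nn_integral_density)
  also have "of_nat (Suc n) * (ennreal k * (\<integral>\<^sup>+t. f t \<partial>gegenbauer_measure ((real n - 1) / 2))) =
      ennreal (real n * unit_ball_vol (real n)) * (\<integral>\<^sup>+t. f t \<partial>gegenbauer_measure ((real n - 1) / 2))"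
  proof -
    have "of_nat (Suc n) * ennreal k = ennreal (real (Suc n) * k)"
      using k by (simp add: ennreal_mult ennreal_of_nat_eq_real_of_nat del: of_nat_Suc)
    also have "real (Suc n) * k = real n * unit_ball_vol (real n)"
      by (simp add: k_def)
    finally show ?thesis
      by (simp only: mult.assoc[symmetric])
  qed
  finally show ?thesis .
qed

section \<open>Completeness\<close>

lemma sets_sphere_measure: "sets (sphere_measure n) = sets (restrict_space (\<Pi>\<^sub>M i\<in>{..n}. borel) (unit_sphere n))"
  by (simp add: sphere_measure_def)

lemma space_sphere_measure: "space (sphere_measure n) = unit_sphere n"
  unfolding sets_eq_imp_space_eq[OF sets_sphere_measure]
  by (auto simp: space_restrict_space space_PiM unit_sphere_def)

lemma unit_sphere_first_coordinate:
  assumes "x \<in> unit_sphere n"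
  shows "x 0 \<in> {-1..1}"
proof -
  have "(x 0)\<^sup>2 \<le> (\<Sum>i\<le>n. (x i)\<^sup>2)"
    by (intro member_le_sum) auto
  then show ?thesis
    using assms by (simp add: unit_sphere_def abs_square_le_1 abs_le_iff)
qed

lemma zonal_L1_cong:
  assumes "\<And>t. t \<in> {-1..1} \<Longrightarrow> g t = h t"
  shows "zonal_L1 n g \<longleftrightarrow> zonal_L1 n h"
  unfolding zonal_L1_def
  by (rule Bochner_Integration.integrable_cong[OF refl])
     (use assms unit_sphere_first_coordinate in \<open>auto simp: space_sphere_measure\<close>)

lemma zonal_L1_iff:
  assumes [measurable]: "g \<in> borel_measurable borel" and n: "n \<ge> 1"
  shows "zonal_L1 n g \<longleftrightarrow> integrable (gegenbauer_measure ((real n - 1) / 2)) g"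
proof -
  have "(\<lambda>x. g (x 0)) \<in> borel_measurable (sphere_measure n)"
    unfolding measurable_cong_sets[OF sets_sphere_measure refl]
    by (rule measurable_restrict_space1) measurable
  moreover have "(\<integral>\<^sup>+x. ennreal (norm (g (x 0))) \<partial>sphere_measure n) =
      ennreal (real n * unit_ball_vol (real n)) *
      (\<integral>\<^sup>+t. ennreal (norm (g t)) \<partial>gegenbauer_measure ((real n - 1) / 2))"
    using n by (intro nn_integral_sphere_measure) measurable
  moreover have "ennreal (real n * unit_ball_vol (real n)) \<noteq> 0"
    using n unit_ball_vol_pos[of "real n"] by (simp add: less_imp_neq[symmetric])
  ultimately show ?thesis
    by (auto simp: zonal_L1_def integrable_iff_bounded ennreal_mult_less_top)
qed

text \<open>Restricting to a meridian recovers measurability of the profile.\<close>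

lemma zonal_L1_borel_measurable:
  assumes "zonal_L1 n g" "n \<ge> 1"
  shows "(\<lambda>t. indicator {-1..1} t * g t) \<in> borel_measurable borel"
proof -
  define e where "e t = (\<lambda>i\<in>{..n}. if i = 0 then t else if i = 1 then sqrt (1 - t\<^sup>2) else 0)" for t :: real
  let ?S = "restrict_space (\<Pi>\<^sub>M i\<in>{..n}. borel) (unit_sphere n) :: (nat \<Rightarrow> real) measure"
  have "e t \<in> unit_sphere n" if "t \<in> {-1..1}" for t
  proof -
    have "{..n} = insert 0 (insert 1 {2..n})"
      using assms(2) by auto
    then have "(\<Sum>i\<le>n. (e t i)\<^sup>2) = t\<^sup>2 + (sqrt (1 - t\<^sup>2))\<^sup>2 + (\<Sum>i=2..n. (e t i)\<^sup>2)"
      by (simp add: e_def)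
    also have "(\<Sum>i=2..n. (e t i)\<^sup>2) = 0"
      by (intro sum.neutral) (auto simp: e_def)
    finally show ?thesis
      using square_le_1_real[OF that] by (simp add: unit_sphere_def e_def)
  qed
  moreover have "e \<in> borel \<rightarrow>\<^sub>M (\<Pi>\<^sub>M i\<in>{..n}. borel)"
    unfolding e_def by measurable
  ultimately have e: "e \<in> restrict_space borel {-1..1} \<rightarrow>\<^sub>M ?S"
    by (intro measurable_restrict_space2 measurable_restrict_space1) (auto simp: space_restrict_space)
  have "(\<lambda>x. g (x 0)) \<in> borel_measurable ?S"
    using borel_measurable_integrable[OF assms(1)[unfolded zonal_L1_def]]
    unfolding measurable_cong_sets[OF sets_sphere_measure refl] .
  from measurable_compose[OF e this] have "g \<in> borel_measurable (restrict_space borel {-1..1})"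
    by (simp add: e_def)
  then show ?thesis
    by (subst (asm) borel_measurable_restrict_space_iff) simp_all
qed

lemma gegenbauer_coeff_cong:
  assumes "\<And>t. t \<in> {-1..1} \<Longrightarrow> g t = h t"
  shows "gegenbauer_coeff lam g l = gegenbauer_coeff lam h l"
proof -
  have "(LBINT t:{-1..1}. g t * gegenbauer lam l t * (1 - t\<^sup>2) powr (lam - 1/2)) =
      (LBINT t:{-1..1}. h t * gegenbauer lam l t * (1 - t\<^sup>2) powr (lam - 1/2))"
    by (rule set_lebesgue_integral_cong) (use assms in auto)
  then show ?thesis
    by (simp add: gegenbauer_coeff_def)
qed

section \<open>Vanishing coefficients force vanishing almost everywhere\<close>

text \<open>Induction on the degree: subtracting the right multiple of the Gegenbauer polynomial of
  that degree cancels the leading coefficient.\<close>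

lemma integral_mult_poly_eq_0:
  assumes "lam > 0" "integrable (gegenbauer_measure lam) g"
    and zero: "\<And>l. (\<integral>t. g t * gegenbauer lam l t \<partial>gegenbauer_measure lam) = 0"
  shows "(\<integral>t. g t * poly p t \<partial>gegenbauer_measure lam) = 0"
proof (induction "degree p" arbitrary: p rule: less_induct)
  case less
  define d k where "d = degree p" and "k = coeff p d / coeff (gegenbauer_poly lam d) d"
  define q where "q = p - smult k (gegenbauer_poly lam d)"
  have int: "integrable (gegenbauer_measure lam) (\<lambda>t. g t * poly r t)" for r
    using assms(2) by (rule integrable_mult_continuous) (intro continuous_intros)
  have p: "poly p t = poly q t + k * gegenbauer lam d t" for t
    by (simp add: q_def poly_gegenbauer_poly)
  have "(\<integral>t. g t * poly p t \<partial>gegenbauer_measure lam) =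
      (\<integral>t. g t * poly q t + k * (g t * gegenbauer lam d t) \<partial>gegenbauer_measure lam)"
    by (simp add: p algebra_simps)
  also have "\<dots> = (\<integral>t. g t * poly q t \<partial>gegenbauer_measure lam)"
    using int[of q] integrable_mult_gegenbauer[OF assms(2), of d] by (simp add: zero)
  also have "\<dots> = 0"
  proof -
    have "degree q \<le> d"
      unfolding q_def d_def
      by (intro degree_diff_le order.trans[OF degree_smult_le] degree_gegenbauer_poly order.refl)
    moreover have "coeff q d = 0"
      using coeff_gegenbauer_poly_pos[OF assms(1), of d] by (simp add: q_def k_def)
    ultimately have "q = 0 \<or> degree q < d"
      by (rule eq_zero_or_degree_less)
    then show ?thesis
      using less[of q] by (auto simp: d_def)
  qed
  finally show ?case .
qed

lemma integral_mult_continuous_eq_0: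
  assumes "lam > 0" "integrable (gegenbauer_measure lam) g" "continuous_on UNIV f"
    and "\<And>l. (\<integral>t. g t * gegenbauer lam l t \<partial>gegenbauer_measure lam) = 0"
  shows "(\<integral>t. g t * f t \<partial>gegenbauer_measure lam) = 0"
proof -
  let ?W = "gegenbauer_measure lam"
  define N where "N = (\<integral>t. \<bar>g t\<bar> \<partial>?W)"
  have "N \<ge> 0"
    unfolding N_def by (rule Bochner_Integration.integral_nonneg) simp
  have "\<bar>\<integral>t. g t * f t \<partial>?W\<bar> \<le> 0 + e" if "e > 0" for e
  proof -
    \<comment> \<open>Uniform error \<open>d\<close> costs at most d N after integration; the added
      1 avoids division by zero when N = 0.\<close>
    define d where "d = e / (N + 1)"
    have "d > 0"
      using that \<open>N \<ge> 0\<close> by (simp add: d_def)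
    then obtain h where "real_polynomial_function h" and h: "\<And>t. t \<in> {-1..1} \<Longrightarrow> \<bar>f t - h t\<bar> < d"
      using Stone_Weierstrass_real_polynomial_function[of "{-1..1}" f d]
        continuous_on_subset[OF assms(3)] by auto
    then obtain a m where "h = (\<lambda>t. \<Sum>i\<le>m. a i * t ^ i)"
      unfolding real_polynomial_function_iff_sum by blast
    then have hp: "h t = poly (\<Sum>i\<le>m. monom (a i) i) t" for t
      by (simp add: poly_sum poly_monom)
    have int: "integrable ?W (\<lambda>t. g t * f t)" "integrable ?W (\<lambda>t. g t * h t)"
      using assms(2,3) by (auto intro!: integrable_mult_continuous continuous_intros simp: hp)
    have "(\<integral>t. g t * h t \<partial>?W) = 0"
      unfolding hp by (rule integral_mult_poly_eq_0) (use assms in auto)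
    then have "(\<integral>t. g t * f t \<partial>?W) = (\<integral>t. g t * f t - g t * h t \<partial>?W)"
      using int by simp
    also have "\<bar>\<dots>\<bar> \<le> (\<integral>t. \<bar>g t * f t - g t * h t\<bar> \<partial>?W)"
      by (rule integral_abs_bound)
    also have "\<dots> \<le> (\<integral>t. d * \<bar>g t\<bar> \<partial>?W)"
    proof (rule integral_mono_AE)
      have "\<bar>g t * f t - g t * h t\<bar> \<le> d * \<bar>g t\<bar>" if "t \<in> {-1..1}" for t
        using h[OF that] unfolding right_diff_distrib[symmetric] abs_mult
        by (subst mult.commute) (intro mult_right_mono, auto)
      then show "AE t in ?W. \<bar>g t * f t - g t * h t\<bar> \<le> d * \<bar>g t\<bar>"
        by (rule eventually_mono[OF AE_gegenbauer_measure_interval])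
    qed (use int assms(2) in auto)
    also have "\<dots> = d * N"
      by (simp add: N_def)
    also have "\<dots> \<le> e"
      using that \<open>N \<ge> 0\<close> by (simp add: d_def field_simps)
    finally show ?thesis by simp
  qed
  then have "\<bar>\<integral>t. g t * f t \<partial>?W\<bar> \<le> 0"
    by (rule field_le_epsilon)
  then show ?thesis by simp
qed

text \<open>Ramps falling from 1 to 0 over a width 1/k carry statements about continuous test
  functions over to half-lines.\<close>

lemma continuous_ramp_limit:
  fixes a t :: real
  shows "(\<lambda>k. max 0 (min 1 (1 - real k * (t - a)))) \<longlonglongrightarrow> indicator {..a} t"
proof (cases "t \<le> a")
  case True
  then have "max 0 (min 1 (1 - real k * (t - a))) = 1" for k
    by (simp add: mult_nonneg_nonpos)
  then show ?thesis using True by simp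
next
  case False
  then obtain N where N: "1 < real N * (t - a)"
    using reals_Archimedean3[of "t - a"] by auto
  have "max 0 (min 1 (1 - real k * (t - a))) = 0" if "k \<ge> N" for k
  proof -
    have "real N * (t - a) \<le> real k * (t - a)"
      using that False by (intro mult_right_mono) auto
    then show ?thesis using N by simp
  qed
  then have "\<forall>\<^sub>F k in sequentially. max 0 (min 1 (1 - real k * (t - a))) = 0"
    unfolding eventually_sequentially by blast
  then show ?thesis
    using False by (simp add: tendsto_eventually)
qed

text \<open>Dominated convergence along ramps annihilates half-lines. These form an
  intersection-stable generator, so the integral of g vanishes on every Borel set, and uniqueness of
  densities finishes.\<close>

lemma gegenbauer_complete:
  assumes "lam > 0" and g: "integrable (gegenbauer_measure lam) g"
    and zero: "\<And>l. (\<integral>t. g t * gegenbauer lam l t \<partial>gegenbauer_measure lam) = 0"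
  shows "AE t in gegenbauer_measure lam. g t = 0"
proof (rule density_unique_real[OF g])
  let ?W = "gegenbauer_measure lam"
  have [measurable]: "g \<in> borel_measurable borel"
    using borel_measurable_integrable[OF g] by simp
  fix A assume A: "A \<in> sets ?W"
  have "sets ?W = sigma_sets UNIV (range (\<lambda>a::real. {..a}))"
    by (simp add: borel_eq_atMost)
  with A have "A \<in> sigma_sets UNIV (range (\<lambda>a::real. {..a}))"
    by simp
  moreover have "Int_stable (range (\<lambda>a::real. {..a}))" "range (\<lambda>a::real. {..a}) \<subseteq> Pow UNIV"
    by (auto simp: Int_stable_def)
  ultimately have "Int_stable (range (\<lambda>a::real. {..a}))" "range (\<lambda>a::real. {..a}) \<subseteq> Pow UNIV"
      "A \<in> sigma_sets UNIV (range (\<lambda>a::real. {..a}))"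
    by blast+
  then have "(\<integral>t\<in>A. g t \<partial>?W) = 0"
  proof (induction rule: sigma_sets_induct_disjoint)
    case (basic A)
    then obtain a where A: "A = {..a}" by auto
    let ?f = "\<lambda>k t. max 0 (min 1 (1 - real k * (t - a)))"
    have "(\<lambda>k. \<integral>t. g t * ?f k t \<partial>?W) \<longlonglongrightarrow> (\<integral>t. g t * indicator {..a} t \<partial>?W)"
    proof (rule integral_dominated_convergence[where w = "\<lambda>t. \<bar>g t\<bar>"])
      show "AE t in ?W. (\<lambda>k. g t * ?f k t) \<longlonglongrightarrow> g t * indicator {..a} t"
        by (intro AE_I2 tendsto_intros continuous_ramp_limit)
      show "AE t in ?W. norm (g t * ?f k t) \<le> \<bar>g t\<bar>" for k
        by (intro AE_I2) (auto simp: abs_mult intro!: mult_left_le)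
    qed (use g in auto)
    moreover have "(\<integral>t. g t * ?f k t \<partial>?W) = 0" for k
      by (rule integral_mult_continuous_eq_0[OF assms(1) g _ zero]) (intro continuous_intros)
    ultimately have "(\<integral>t. g t * indicator {..a} t \<partial>?W) = 0"
      by (simp only: LIMSEQ_const_iff)
    then show ?case
      by (simp add: A set_lebesgue_integral_def mult.commute[of "g _"])
  next
    case empty
    show ?case by (simp add: set_lebesgue_integral_def)
  next
    case (compl A)
    then have A [measurable]: "A \<in> sets ?W"
      by (simp add: borel_eq_atMost)
    \<comment> \<open>The polynomial of index 0 is the constant 1, so the total integral is one of
      the vanishing coefficients.\<close>
    have "(\<integral>t. g t \<partial>?W) = 0"
      using zero[of 0] by simp
    moreover have "(\<integral>t. g t \<partial>?W) = (\<integral>t\<in>A. g t \<partial>?W) + (\<integral>t\<in>UNIV - A. g t \<partial>?W)"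
    proof -
      have int: "set_integrable ?W B g" if "B \<in> sets ?W" for B
        unfolding set_integrable_def by (rule integrable_mult_indicator[OF that g])
      have "UNIV - A \<in> sets ?W"
        by measurable
      then have "(\<integral>t\<in>A \<union> (UNIV - A). g t \<partial>?W) = (\<integral>t\<in>A. g t \<partial>?W) + (\<integral>t\<in>UNIV - A. g t \<partial>?W)"
        by (intro set_integral_Un int A) auto
      then show ?thesis
        by (simp add: set_lebesgue_integral_def)
    qed
    ultimately show ?case using compl by simp
  next
    case (union A)
    then have A [measurable]: "A i \<in> sets ?W" for i
      by (auto simp: borel_eq_atMost)
    have "set_integrable ?W (\<Union>i. A i) g"
      unfolding set_integrable_def by (rule integrable_mult_indicator[OF _ g]) measurable
    then have "(\<integral>t\<in>(\<Union>i. A i). g t \<partial>?W) = (\<Sum>i. \<integral>t\<in>A i. g t \<partial>?W)"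
      using union(1) A by (intro lebesgue_integral_countable_add) (auto simp: disjoint_family_on_def)
    then show ?case using union by simp
  qed
  then show "(\<integral>t\<in>A. g t \<partial>?W) = (\<integral>t\<in>A. 0 \<partial>?W)"
    by simp
qed simp

section \<open>Remainders of the Poisson series\<close>

definition poisson_remainder :: "real \<Rightarrow> nat \<Rightarrow> real \<Rightarrow> real \<Rightarrow> real" where
  "poisson_remainder lam m t r = suminf (poisson_term lam t r) - (\<Sum>l<m. poisson_term lam t r l)"

lemma poisson_term_measurable [measurable (raw)]:
  assumes [measurable]: "f \<in> borel_measurable M" "g \<in> borel_measurable M"
  shows "(\<lambda>x. poisson_term lam (f x) (g x) l) \<in> borel_measurable M"
  unfolding poisson_term_def by measurable

lemma poisson_remainder_measurable [measurable (raw)]: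
  assumes [measurable]: "f \<in> borel_measurable M" "g \<in> borel_measurable M"
  shows "(\<lambda>x. poisson_remainder lam m (f x) (g x)) \<in> borel_measurable M"
  unfolding poisson_remainder_def by measurable

lemma summable_abs_poisson_term:
  assumes "t \<in> {-1..1}" "0 \<le> r" "r < 1" "lam > 0"
  shows "summable (\<lambda>l. \<bar>poisson_term lam t r l\<bar>)"
  using poisson_term_bound[OF assms(1,2,4)] summable_poisson_at_1[OF assms(2-4)]
  by (intro summable_comparison_test[of "\<lambda>l. \<bar>poisson_term lam t r l\<bar>" "poisson_term lam 1 r"]) auto

text \<open>Passing from radius R to r multiplies the term of index l by (r / R)^l, which is at most
  (r / R)^m for every surviving index l >= m. The majorant is finite because R < 1.\<close>

lemma poisson_remainder_bound:
  assumes t: "t \<in> {-1..1}" and r: "0 \<le> r" "r \<le> R" and R: "0 < R" "R < 1" and lam: "lam > 0"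
  shows "\<bar>poisson_remainder lam m t r\<bar> \<le> (r / R) ^ m * suminf (poisson_term lam 1 R)"
proof -
  let ?p = "poisson_term lam t r" and ?q = "poisson_term lam 1 R"
  have abs: "summable (\<lambda>l. \<bar>?p l\<bar>)"
    using assms by (intro summable_abs_poisson_term) auto
  have q: "summable ?q"
    using assms by (intro summable_poisson_at_1) auto
  have q_nonneg: "?q l \<ge> 0" for l
    using assms by (intro poisson_term_at_1_nonneg) auto
  have "\<bar>?p (l + m)\<bar> \<le> (r / R) ^ m * ?q (l + m)" for l
  proof -
    have "\<bar>?p (l + m)\<bar> \<le> poisson_term lam 1 r (l + m)"
      using assms by (intro poisson_term_bound) auto
    also have "\<dots> = (r / R) ^ (l + m) * ?q (l + m)"
      using R by (simp add: poisson_term_def power_divide)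
    also have "\<dots> \<le> (r / R) ^ m * ?q (l + m)"
      using assms by (intro mult_right_mono q_nonneg power_decreasing) auto
    finally show ?thesis .
  qed
  then have "(\<Sum>l. \<bar>?p (l + m)\<bar>) \<le> (\<Sum>l. (r / R) ^ m * ?q (l + m))"
    using abs q by (intro suminf_le summable_mult summable_ignore_initial_segment)
  also have "\<dots> = (r / R) ^ m * (\<Sum>l. ?q (l + m))"
    using q by (intro suminf_mult summable_ignore_initial_segment)
  also have "\<dots> \<le> (r / R) ^ m * suminf ?q"
    using suminf_minus_initial_segment[OF q, of m] q_nonneg r R
    by (intro mult_left_mono) (auto intro: sum_nonneg)
  finally have "(\<Sum>l. \<bar>?p (l + m)\<bar>) \<le> (r / R) ^ m * suminf ?q" .
  moreover have "poisson_remainder lam m t r = (\<Sum>l. ?p (l + m))"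
    using suminf_minus_initial_segment[OF summable_rabs_cancel[OF abs], of m]
    by (simp add: poisson_remainder_def)
  moreover have "\<bar>\<Sum>l. ?p (l + m)\<bar> \<le> (\<Sum>l. \<bar>?p (l + m)\<bar>)"
    using abs by (intro summable_rabs summable_ignore_initial_segment[of "\<lambda>l. \<bar>?p l\<bar>"])
  ultimately show ?thesis by linarith
qed

lemma integrable_poisson_term:
  assumes "lam \<ge> 1/2"
  shows "integrable (gegenbauer_measure lam) (\<lambda>t. poisson_term lam t r l)"
  unfolding poisson_term_def using integrable_gegenbauer[OF assms] by simp

lemma integral_poisson_term_gegenbauer:
  assumes "lam \<ge> 1/2"
  shows "(\<integral>t. poisson_term lam t r l * gegenbauer lam k t \<partial>gegenbauer_measure lam) =
    (if l = k then r ^ k * ((lam + real k) / lam) * gegenbauer_norm lam k else 0)"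
proof -
  let ?W = "gegenbauer_measure lam"
  have "(\<integral>t. poisson_term lam t r l * gegenbauer lam k t \<partial>?W) =
      (\<integral>t. r ^ l * ((lam + real l) / lam) * (gegenbauer lam l t * gegenbauer lam k t) \<partial>?W)"
    by (simp add: poisson_term_def mult_ac)
  also have "\<dots> = r ^ l * ((lam + real l) / lam) * (\<integral>t. gegenbauer lam l t * gegenbauer lam k t \<partial>?W)"
    by (rule integral_mult_right_zero)
  finally show ?thesis
    using gegenbauer_orthogonal[OF assms, of l k] by (simp add: gegenbauer_norm_def)
qed

text \<open>For fixed r < 1 the series is dominated by its values at t = 1, so it may be integrated
  termwise, and orthogonality keeps a single term.\<close>

lemma
  assumes lam: "lam \<ge> 1/2" and r: "0 \<le> r" "r < 1"
  shows integrable_poisson: "integrable (gegenbauer_measure lam) (\<lambda>t. suminf (poisson_term lam t r))"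
    and integral_poisson_gegenbauer:
      "(\<integral>t. suminf (poisson_term lam t r) * gegenbauer lam k t \<partial>gegenbauer_measure lam) =
        r ^ k * ((lam + real k) / lam) * gegenbauer_norm lam k"
proof -
  let ?W = "gegenbauer_measure lam"
  have lam0: "lam > 0"
    using lam by simp
  have sm1: "summable (poisson_term lam 1 r)"
    using r lam by (intro summable_poisson_at_1) auto
  have bound: "\<bar>suminf (poisson_term lam t r)\<bar> \<le> suminf (poisson_term lam 1 r)" if "t \<in> {-1..1}" for t
  proof -
    have abs: "summable (\<lambda>l. \<bar>poisson_term lam t r l\<bar>)"
      using that r lam by (intro summable_abs_poisson_term) auto
    have "\<bar>suminf (poisson_term lam t r)\<bar> \<le> (\<Sum>l. \<bar>poisson_term lam t r l\<bar>)"
      using abs by (rule summable_rabs)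
    also have "\<dots> \<le> suminf (poisson_term lam 1 r)"
      using that r lam0 by (intro suminf_le abs sm1 poisson_term_bound)
    finally show ?thesis .
  qed
  have [measurable]: "(\<lambda>t. suminf (poisson_term lam t r)) \<in> borel_measurable borel"
    by measurable
  show "integrable ?W (\<lambda>t. suminf (poisson_term lam t r))"
    using bound by (intro integrable_gegenbauer_measure_bounded[OF lam]) measurable
  let ?f = "\<lambda>l t. poisson_term lam t r l * gegenbauer lam k t"
  have int: "integrable ?W (?f l)" for l
    by (intro integrable_mult_gegenbauer integrable_poisson_term lam)
  have "(\<integral>t. (\<Sum>l. ?f l t) \<partial>?W) = (\<Sum>l. \<integral>t. ?f l t \<partial>?W)"
  proof (rule integral_suminf)
    show "AE t in ?W. summable (\<lambda>l. norm (?f l t))"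
    proof (rule eventually_mono[OF AE_gegenbauer_measure_interval])
      fix t :: real assume "t \<in> {-1..1}"
      then show "summable (\<lambda>l. norm (?f l t))"
        using summable_abs_poisson_term[of t r lam] r lam0 by (simp add: abs_mult summable_mult2)
    qed
    show "summable (\<lambda>l. \<integral>t. norm (?f l t) \<partial>?W)"
    proof (rule summable_comparison_test)
      have int_abs: "integrable ?W (\<lambda>t. \<bar>gegenbauer lam k t\<bar>)"
        using integrable_gegenbauer[OF lam] by simp
      have "(\<integral>t. norm (?f l t) \<partial>?W) \<le> poisson_term lam 1 r l * (\<integral>t. \<bar>gegenbauer lam k t\<bar> \<partial>?W)" for l
      proof -
        have "(\<integral>t. norm (?f l t) \<partial>?W) \<le> (\<integral>t. poisson_term lam 1 r l * \<bar>gegenbauer lam k t\<bar> \<partial>?W)"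
        proof (rule integral_mono_AE)
          show "AE t in ?W. norm (?f l t) \<le> poisson_term lam 1 r l * \<bar>gegenbauer lam k t\<bar>"
            using poisson_term_bound[OF _ r(1) lam0]
            by (intro eventually_mono[OF AE_gegenbauer_measure_interval])
               (auto simp: abs_mult intro!: mult_right_mono)
        qed (use int int_abs in auto)
        then show ?thesis by simp
      qed
      then show "\<exists>N. \<forall>l\<ge>N. norm (\<integral>t. norm (?f l t) \<partial>?W) \<le>
          poisson_term lam 1 r l * (\<integral>t. \<bar>gegenbauer lam k t\<bar> \<partial>?W)"
        by simp
      show "summable (\<lambda>l. poisson_term lam 1 r l * (\<integral>t. \<bar>gegenbauer lam k t\<bar> \<partial>?W))"
        by (intro summable_mult2 sm1)
    qed
  qed (rule int)
  moreover have "(\<integral>t. suminf (poisson_term lam t r) * gegenbauer lam k t \<partial>?W) = (\<integral>t. (\<Sum>l. ?f l t) \<partial>?W)"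
  proof (rule integral_cong_AE)
    show "AE t in ?W. suminf (poisson_term lam t r) * gegenbauer lam k t = (\<Sum>l. ?f l t)"
    proof (rule eventually_mono[OF AE_gegenbauer_measure_interval])
      fix t :: real assume "t \<in> {-1..1}"
      then have "summable (poisson_term lam t r)"
        using summable_rabs_cancel[OF summable_abs_poisson_term[of t r lam]] r lam0 by simp
      then show "suminf (poisson_term lam t r) * gegenbauer lam k t = (\<Sum>l. ?f l t)"
        by (rule suminf_mult2)
    qed
  qed measurable
  ultimately show "(\<integral>t. suminf (poisson_term lam t r) * gegenbauer lam k t \<partial>?W) =
      r ^ k * ((lam + real k) / lam) * gegenbauer_norm lam k"
    using sums_unique[OF sums_single[of k "\<lambda>_. r ^ k * ((lam + real k) / lam) * gegenbauer_norm lam k"]]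
    by (simp add: integral_poisson_term_gegenbauer[OF lam])
qed

lemma
  assumes lam: "lam \<ge> 1/2" and r: "0 \<le> r" "r < 1"
  shows integrable_poisson_remainder: "integrable (gegenbauer_measure lam) (\<lambda>t. poisson_remainder lam m t r)"
    and integral_poisson_remainder_gegenbauer:
      "(\<integral>t. poisson_remainder lam m t r * gegenbauer lam k t \<partial>gegenbauer_measure lam) =
        (if k < m then 0 else r ^ k * ((lam + real k) / lam) * gegenbauer_norm lam k)"
proof -
  let ?W = "gegenbauer_measure lam"
  show "integrable ?W (\<lambda>t. poisson_remainder lam m t r)"
    unfolding poisson_remainder_def
    by (intro Bochner_Integration.integrable_diff Bochner_Integration.integrable_sum integrable_poisson integrable_poisson_term assms)
  have "(\<integral>t. poisson_remainder lam m t r * gegenbauer lam k t \<partial>?W) =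
      (\<integral>t. suminf (poisson_term lam t r) * gegenbauer lam k t \<partial>?W)
      - (\<Sum>l<m. \<integral>t. poisson_term lam t r l * gegenbauer lam k t \<partial>?W)"
    using integrable_mult_gegenbauer[OF integrable_poisson[OF assms]]
      integrable_mult_gegenbauer[OF integrable_poisson_term[OF lam]]
    by (simp add: poisson_remainder_def left_diff_distrib sum_distrib_right Bochner_Integration.integral_sum)
  then show "(\<integral>t. poisson_remainder lam m t r * gegenbauer lam k t \<partial>?W) =
        (if k < m then 0 else r ^ k * ((lam + real k) / lam) * gegenbauer_norm lam k)"
    by (simp add: integral_poisson_gegenbauer[OF assms] integral_poisson_term_gegenbauer[OF lam])
qed

text \<open>
  For \<open>r \<le> 1/2\<close> the series is dominated termwise; for \<open>r \<ge> 1/2\<close> positivity of the Poisson kernel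
  bounds its \<open>L\<^sup>1\<close> norm uniformly.
\<close>

lemma poisson_remainder_L1_bound:
  assumes lam: "lam \<ge> 1/2"
  obtains K where "K \<ge> 0" "\<And>r. r \<in> {0<..<1} \<Longrightarrow>
    (\<integral>\<^sup>+t. ennreal \<bar>poisson_remainder lam m t r\<bar> \<partial>gegenbauer_measure lam) \<le> ennreal (K * r ^ m)"
proof -
  let ?W = "gegenbauer_measure lam"
  interpret finite_measure ?W
    by (rule finite_gegenbauer_measure[OF lam])
  define w where "w = measure ?W UNIV"
  define S D where "S = suminf (poisson_term lam 1 (1/2))" and "D = (\<Sum>l<m. poisson_term lam 1 1 l)"
  \<comment> \<open>The factor 2^m has two sources: the comparison radius 1/2 when r <= 1/2, and 1
    <= (2 r)^m when r > 1/2. The two contributions are added so that one constant serves both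
    cases.\<close>
  define K where "K = 2 ^ m * (\<bar>S\<bar> * w + (gegenbauer_norm lam 0 + D * w))"
  have lam0: "lam > 0" using lam by simp
  have w: "w \<ge> 0"
    by (simp add: w_def)
  have D: "D \<ge> 0"
    unfolding D_def using lam0 by (intro sum_nonneg poisson_term_at_1_nonneg) auto
  have nonneg: "0 \<le> \<bar>S\<bar> * w" "0 \<le> gegenbauer_norm lam 0 + D * w"
    using w D gegenbauer_norm_pos[OF lam, of 0] by simp_all
  have "(\<integral>t. \<bar>poisson_remainder lam m t r\<bar> \<partial>?W) \<le> K * r ^ m" if r: "r \<in> {0<..<1}" for r
  proof (cases "r \<le> 1/2")
    case True
    have "(\<integral>t. \<bar>poisson_remainder lam m t r\<bar> \<partial>?W) \<le> (\<integral>t. (r / (1/2)) ^ m * S \<partial>?W)"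
    proof (rule integral_mono_AE)
      show "AE t in ?W. \<bar>poisson_remainder lam m t r\<bar> \<le> (r / (1/2)) ^ m * S"
        unfolding S_def using r True lam0
        by (intro eventually_mono[OF AE_gegenbauer_measure_interval] poisson_remainder_bound) auto
    qed (use integrable_poisson_remainder[OF lam, of r m] r in auto)
    also have "\<dots> = r ^ m * (2 ^ m * (S * w))"
      by (simp add: w_def power_mult_distrib)
    also have "\<dots> \<le> r ^ m * (2 ^ m * (\<bar>S\<bar> * w + (gegenbauer_norm lam 0 + D * w)))"
    proof (intro mult_left_mono)
      have "S * w \<le> \<bar>S\<bar> * w"
        using w by (intro mult_right_mono) auto
      then show "S * w \<le> \<bar>S\<bar> * w + (gegenbauer_norm lam 0 + D * w)"
        using nonneg(2) by linarith
    qed (use r in auto)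
    finally show ?thesis
      by (simp add: K_def mult_ac)
  next
    case False
    have int_P: "integrable ?W (\<lambda>t. suminf (poisson_term lam t r))"
      using r by (intro integrable_poisson lam) auto
    have "(\<integral>t. \<bar>poisson_remainder lam m t r\<bar> \<partial>?W) \<le> (\<integral>t. suminf (poisson_term lam t r) + D \<partial>?W)"
    proof (rule integral_mono_AE)
      show "AE t in ?W. \<bar>poisson_remainder lam m t r\<bar> \<le> suminf (poisson_term lam t r) + D"
      proof (rule eventually_mono[OF AE_gegenbauer_measure_interval])
        fix t :: real assume t: "t \<in> {-1..1}"
        have "\<bar>\<Sum>l<m. poisson_term lam t r l\<bar> \<le> (\<Sum>l<m. \<bar>poisson_term lam t r l\<bar>)"
          by (rule sum_abs)
        also have "\<dots> \<le> D"
          unfolding D_def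
        proof (rule sum_mono)
          fix l
          have "\<bar>poisson_term lam t r l\<bar> \<le> poisson_term lam 1 r l"
            using t r lam0 by (intro poisson_term_bound) auto
          also have "\<dots> = r ^ l * poisson_term lam 1 1 l"
            by (simp add: poisson_term_def)
          also have "\<dots> \<le> 1 * poisson_term lam 1 1 l"
            using r lam0 by (intro mult_right_mono poisson_term_at_1_nonneg power_le_one) auto
          finally show "\<bar>poisson_term lam t r l\<bar> \<le> poisson_term lam 1 1 l"
            by simp
        qed
        moreover have "suminf (poisson_term lam t r) \<ge> 0"
          using t r lam0 by (intro poisson_nonneg) auto
        ultimately show "\<bar>poisson_remainder lam m t r\<bar> \<le> suminf (poisson_term lam t r) + D"
          unfolding poisson_remainder_def by linarith
      qed
    qed (use integrable_poisson_remainder[OF lam, of r m] int_P r in auto)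
    \<comment> \<open>The coefficient of index 0 carries the factor r^0, so the mass of the Poisson
      series does not depend on r.\<close>
    also have "\<dots> = gegenbauer_norm lam 0 + D * w"
      using integral_poisson_gegenbauer[OF lam, of r 0] int_P r lam0 by (simp add: w_def)
    also have "\<dots> \<le> \<bar>S\<bar> * w + (gegenbauer_norm lam 0 + D * w)"
      using nonneg(1) by linarith
    also have "\<dots> \<le> (2 * r) ^ m * (\<bar>S\<bar> * w + (gegenbauer_norm lam 0 + D * w))"
      using False nonneg mult_right_mono[OF one_le_power[of "2 * r" m]] by fastforce
    finally show ?thesis
      by (simp add: K_def power_mult_distrib mult_ac)
  qed
  then have "(\<integral>\<^sup>+t. ennreal \<bar>poisson_remainder lam m t r\<bar> \<partial>?W) \<le> ennreal (K * r ^ m)" if "r \<in> {0<..<1}" for r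
    using that integrable_poisson_remainder[OF lam, of r m]
    by (subst nn_integral_eq_integral) (auto intro: ennreal_leI)
  moreover have "K \<ge> 0"
    using nonneg by (simp add: K_def)
  ultimately show thesis
    using that by blast
qed

section \<open>The iterated integral\<close>

text \<open>The nested integral becomes one integral over the plane, as Fubini requires. The strict
  inequalities keep both powers away from base 0.\<close>

definition hardy_kernel :: "real \<Rightarrow> real \<Rightarrow> real \<Rightarrow> real \<Rightarrow> real" where
  "hardy_kernel \<alpha> \<beta> R r = (if 0 < r \<and> r < R \<and> R < 1 then R powr \<alpha> * r powr \<beta> else 0)"

lemma hardy_kernel_nonneg: "hardy_kernel \<alpha> \<beta> R r \<ge> 0"
  by (simp add: hardy_kernel_def)

lemma hardy_kernel_measurable [measurable (raw)]:
  assumes [measurable]: "f \<in> borel_measurable M" "g \<in> borel_measurable M"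
  shows "(\<lambda>x. hardy_kernel \<alpha> \<beta> (f x) (g x)) \<in> borel_measurable M"
  unfolding hardy_kernel_def by measurable

lemma nn_integral_powr_from_0:
  assumes "s > -1" "c \<ge> 0"
  shows "(\<integral>\<^sup>+r. ennreal (r powr s) * indicator {0<..<c} r \<partial>lborel) = ennreal (c powr (s + 1) / (s + 1))"
proof -
  have "AE r in lborel. r \<noteq> 0 \<and> r \<noteq> c"
    using AE_lborel_singleton[of 0] AE_lborel_singleton[of c] by eventually_elim auto
  then have "(\<integral>\<^sup>+r. ennreal (r powr s) * indicator {0<..<c} r \<partial>lborel) =
      (\<integral>\<^sup>+r. ennreal (r powr s) * indicator {0..c} r \<partial>lborel)"
    by (intro nn_integral_cong_AE, elim eventually_mono) (auto simp: indicator_def)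
  also have "\<dots> = ennreal (c powr (s + 1) / (s + 1))"
    using assms by (intro nn_integral_has_integral_lebesgue' has_integral_powr_from_0) auto
  finally show ?thesis .
qed

text \<open>The first condition is integrability of the inner power at r = 0, the second that of the
  resulting power of R at R = 0.\<close>

lemma nn_integral_hardy_kernel:
  assumes "\<beta> + real k > -1" "\<alpha> + \<beta> + real k + 2 > 0"
  shows "(\<integral>\<^sup>+p. ennreal (hardy_kernel \<alpha> \<beta> (fst p) (snd p) * snd p ^ k) \<partial>(lborel \<Otimes>\<^sub>M lborel)) =
    ennreal (1 / ((\<beta> + real k + 1) * (\<alpha> + \<beta> + real k + 2)))"
proof -
  define s where "s = \<beta> + real k"
  have "(\<integral>\<^sup>+p. ennreal (hardy_kernel \<alpha> \<beta> (fst p) (snd p) * snd p ^ k) \<partial>(lborel \<Otimes>\<^sub>M lborel)) =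
      (\<integral>\<^sup>+R. (\<integral>\<^sup>+r. ennreal (hardy_kernel \<alpha> \<beta> R r * r ^ k) \<partial>lborel) \<partial>lborel)"
    by (subst lborel.nn_integral_fst[symmetric]) simp_all
  also have "\<dots> = (\<integral>\<^sup>+R. ennreal (1 / (s + 1)) * (ennreal (R powr (\<alpha> + s + 1)) * indicator {0<..<1} R) \<partial>lborel)"
  proof (rule nn_integral_cong)
    fix R :: real
    show "(\<integral>\<^sup>+r. ennreal (hardy_kernel \<alpha> \<beta> R r * r ^ k) \<partial>lborel) =
        ennreal (1 / (s + 1)) * (ennreal (R powr (\<alpha> + s + 1)) * indicator {0<..<1} R)"
    proof (cases "R \<in> {0<..<1}")
      case True
      have "hardy_kernel \<alpha> \<beta> R r * r ^ k = R powr \<alpha> * (r powr s * indicator {0<..<R} r)" for r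
        using True by (simp add: hardy_kernel_def s_def powr_add powr_realpow indicator_def)
      then have "(\<integral>\<^sup>+r. ennreal (hardy_kernel \<alpha> \<beta> R r * r ^ k) \<partial>lborel) =
          (\<integral>\<^sup>+r. ennreal (R powr \<alpha>) * (ennreal (r powr s) * indicator {0<..<R} r) \<partial>lborel)"
        by (simp add: ennreal_mult ennreal_indicator)
      also have "\<dots> = ennreal (R powr \<alpha>) * (\<integral>\<^sup>+r. ennreal (r powr s) * indicator {0<..<R} r \<partial>lborel)"
        by (rule nn_integral_cmult) measurable
      also have "(\<integral>\<^sup>+r. ennreal (r powr s) * indicator {0<..<R} r \<partial>lborel) = ennreal (R powr (s + 1) / (s + 1))"
        using True assms(1) by (intro nn_integral_powr_from_0) (auto simp: s_def)
      also have "ennreal (R powr \<alpha>) * \<dots> = ennreal (1 / (s + 1) * R powr (\<alpha> + s + 1))"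
        using assms(1) by (simp add: ennreal_mult[symmetric] s_def powr_add[symmetric] add_ac)
      finally show ?thesis
        using True assms(1) by (simp add: ennreal_mult[symmetric] s_def)
    next
      case False
      then have "hardy_kernel \<alpha> \<beta> R r = 0" for r
        by (auto simp: hardy_kernel_def)
      then show ?thesis
        using False by simp
    qed
  qed
  also have "\<dots> = ennreal (1 / (s + 1)) * (\<integral>\<^sup>+R. ennreal (R powr (\<alpha> + s + 1)) * indicator {0<..<1} R \<partial>lborel)"
    by (rule nn_integral_cmult) measurable
  also have "(\<integral>\<^sup>+R. ennreal (R powr (\<alpha> + s + 1)) * indicator {0<..<1} R \<partial>lborel) =
      ennreal (1 powr (\<alpha> + s + 1 + 1) / (\<alpha> + s + 1 + 1))"
    using assms(2) by (intro nn_integral_powr_from_0) (auto simp: s_def)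
  also have "ennreal (1 / (s + 1)) * \<dots> = ennreal (1 / ((s + 1) * (\<alpha> + s + 2)))"
    using assms by (subst ennreal_mult[symmetric]) (auto simp: s_def add_ac)
  finally show ?thesis
    by (simp add: s_def add_ac)
qed

lemma integral_hardy_kernel:
  assumes "\<beta> + real k > -1" "\<alpha> + \<beta> + real k + 2 > 0"
  shows "(\<integral>p. hardy_kernel \<alpha> \<beta> (fst p) (snd p) * snd p ^ k \<partial>(lborel \<Otimes>\<^sub>M lborel)) =
    1 / ((\<beta> + real k + 1) * (\<alpha> + \<beta> + real k + 2))"
proof -
  have "hardy_kernel \<alpha> \<beta> (fst p) (snd p) * snd p ^ k \<ge> 0" for p
    by (auto simp: hardy_kernel_def)
  then have "(\<integral>p. hardy_kernel \<alpha> \<beta> (fst p) (snd p) * snd p ^ k \<partial>(lborel \<Otimes>\<^sub>M lborel)) =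
      enn2real (\<integral>\<^sup>+p. ennreal (hardy_kernel \<alpha> \<beta> (fst p) (snd p) * snd p ^ k) \<partial>(lborel \<Otimes>\<^sub>M lborel))"
    by (intro integral_eq_nn_integral) auto
  then show ?thesis
    using assms by (simp only: nn_integral_hardy_kernel) simp
qed

lemma pair_sigma_finite_gegenbauer:
  assumes "lam \<ge> 1/2"
  shows "pair_sigma_finite (gegenbauer_measure lam) ((lborel :: real measure) \<Otimes>\<^sub>M (lborel :: real measure))"
proof -
  interpret W: finite_measure "gegenbauer_measure lam"
    by (rule finite_gegenbauer_measure[OF assms])
  show ?thesis
    by (intro pair_sigma_finite.intro W.sigma_finite_measure_axioms lborel_pair.P.sigma_finite_measure_axioms)
qed

text \<open>With t integrated innermost, the uniform L1 bound replaces the remainder by K r^m, and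
  what is left is a moment of the kernel. The bounded factor \<open>q\<close> is 1 for integrability
  and a Gegenbauer polynomial for the coefficients.\<close>

lemma integrable_hardy_poisson_remainder:
  assumes lam: "lam \<ge> 1/2" and exponents: "\<beta> + real m > -1" "\<alpha> + \<beta> + real m + 2 > 0"
    and q [measurable]: "q \<in> borel_measurable borel" and B: "\<And>t. t \<in> {-1..1} \<Longrightarrow> \<bar>q t\<bar> \<le> B"
  shows "integrable (gegenbauer_measure lam \<Otimes>\<^sub>M (lborel \<Otimes>\<^sub>M lborel))
    (\<lambda>(t, R, r). hardy_kernel \<alpha> \<beta> R r * poisson_remainder lam m t r * q t)"
proof (rule integrableI_bounded)
  let ?W = "gegenbauer_measure lam" and ?L = "(lborel :: real measure) \<Otimes>\<^sub>M (lborel :: real measure)"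
  let ?f = "\<lambda>(t, R, r). hardy_kernel \<alpha> \<beta> R r * poisson_remainder lam m t r * q t"
  interpret pair_sigma_finite ?W ?L
    by (rule pair_sigma_finite_gegenbauer[OF lam])
  obtain K where K: "K \<ge> 0" "\<And>r. r \<in> {0<..<1} \<Longrightarrow>
      (\<integral>\<^sup>+t. ennreal \<bar>poisson_remainder lam m t r\<bar> \<partial>?W) \<le> ennreal (K * r ^ m)"
    using poisson_remainder_L1_bound[OF lam, of m] by blast
  have "B \<ge> 0"
    using B[of 0] by simp
  show meas [measurable]: "?f \<in> borel_measurable (?W \<Otimes>\<^sub>M ?L)"
    by measurable
  have "(\<integral>\<^sup>+x. ennreal (norm (?f x)) \<partial>(?W \<Otimes>\<^sub>M ?L)) =
      (\<integral>\<^sup>+p. (\<integral>\<^sup>+t. ennreal (norm (?f (t, p))) \<partial>?W) \<partial>?L)"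
    by (rule nn_integral_snd[symmetric]) measurable
  also have "\<dots> \<le> (\<integral>\<^sup>+p. ennreal (B * K) * ennreal (hardy_kernel \<alpha> \<beta> (fst p) (snd p) * snd p ^ m) \<partial>?L)"
  proof (rule nn_integral_mono)
    fix p :: "real \<times> real"
    obtain R r where p: "p = (R, r)" by fastforce
    define h where "h = hardy_kernel \<alpha> \<beta> R r"
    have "h \<ge> 0" unfolding h_def by (rule hardy_kernel_nonneg)
    show "(\<integral>\<^sup>+t. ennreal (norm (?f (t, p))) \<partial>?W) \<le>
        ennreal (B * K) * ennreal (hardy_kernel \<alpha> \<beta> (fst p) (snd p) * snd p ^ m)"
    proof (cases "0 < r \<and> r < R \<and> R < 1")
      case True
      have "(\<integral>\<^sup>+t. ennreal (norm (?f (t, p))) \<partial>?W) \<le>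
          (\<integral>\<^sup>+t. ennreal (h * B) * ennreal \<bar>poisson_remainder lam m t r\<bar> \<partial>?W)"
      proof (rule nn_integral_mono_AE, rule eventually_mono[OF AE_gegenbauer_measure_interval])
        fix t :: real assume "t \<in> {-1..1}"
        then have "norm (?f (t, p)) \<le> h * B * \<bar>poisson_remainder lam m t r\<bar>"
          using \<open>h \<ge> 0\<close> B[of t] mult_mono[of "\<bar>q t\<bar>" B "h * \<bar>poisson_remainder lam m t r\<bar>"
              "h * \<bar>poisson_remainder lam m t r\<bar>"] \<open>B \<ge> 0\<close>
          by (simp add: p h_def[symmetric] abs_mult mult_ac)
        then show "ennreal (norm (?f (t, p))) \<le> ennreal (h * B) * ennreal \<bar>poisson_remainder lam m t r\<bar>"
          using \<open>h \<ge> 0\<close> \<open>B \<ge> 0\<close> by (simp add: ennreal_mult[symmetric] ennreal_leI)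
      qed
      also have "\<dots> = ennreal (h * B) * (\<integral>\<^sup>+t. ennreal \<bar>poisson_remainder lam m t r\<bar> \<partial>?W)"
        by (rule nn_integral_cmult) measurable
      also have "\<dots> \<le> ennreal (h * B) * ennreal (K * r ^ m)"
        using True by (intro mult_left_mono K(2)) auto
      also have "\<dots> = ennreal (B * K) * ennreal (hardy_kernel \<alpha> \<beta> (fst p) (snd p) * snd p ^ m)"
        using \<open>h \<ge> 0\<close> \<open>B \<ge> 0\<close> K(1) True
        by (simp add: p h_def[symmetric] ennreal_mult[symmetric] mult_ac)
      finally show ?thesis .
    next
      case False
      then have "hardy_kernel \<alpha> \<beta> R r = 0"
        by (auto simp: hardy_kernel_def)
      then show ?thesis by (simp add: p)
    qed
  qed
  also have "\<dots> = ennreal (B * K) * (\<integral>\<^sup>+p. ennreal (hardy_kernel \<alpha> \<beta> (fst p) (snd p) * snd p ^ m) \<partial>?L)"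
    by (rule nn_integral_cmult) measurable
  also have "\<dots> < \<infinity>"
    unfolding nn_integral_hardy_kernel[OF exponents] by (simp add: ennreal_mult_less_top)
  finally show "(\<integral>\<^sup>+x. ennreal (norm (?f x)) \<partial>(?W \<Otimes>\<^sub>M ?L)) < \<infinity>" .
qed

definition hardy_poisson :: "real \<Rightarrow> nat \<Rightarrow> real \<Rightarrow> real \<Rightarrow> real \<Rightarrow> real" where
  "hardy_poisson lam m \<alpha> \<beta> t =
    (LBINT R:{0..1}. R powr \<alpha> * (LBINT r:{0..R}. r powr \<beta> * poisson_remainder lam m t r))"

lemma inner_integral_measurable [measurable (raw)]:
  assumes [measurable]: "f \<in> borel_measurable M" "g \<in> borel_measurable M"
  shows "(\<lambda>x. LBINT r:{0..g x}. r powr \<beta> * poisson_remainder lam m (f x) r) \<in> borel_measurable M"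
proof -
  \<comment> \<open>Turning the moving domain into a condition makes the integrand jointly
    measurable in x and r.\<close>
  have "(LBINT r:{0..g x}. r powr \<beta> * poisson_remainder lam m (f x) r) =
      (\<integral>r. (if 0 \<le> r \<and> r \<le> g x then r powr \<beta> * poisson_remainder lam m (f x) r else 0) \<partial>lborel)" for x
    unfolding set_lebesgue_integral_def by (intro Bochner_Integration.integral_cong) (auto simp: indicator_def)
  then show ?thesis by simp
qed

lemma hardy_poisson_measurable [measurable]: "hardy_poisson lam m \<alpha> \<beta> \<in> borel_measurable borel"
  unfolding hardy_poisson_def[abs_def] set_lebesgue_integral_def[where A = "{0..1}"]
  by measurable

text \<open>Fubini provides integrable sections for almost every t only. The integrability of the
  outer integrand is recorded because a Bochner integral that fails to exist has value 0.\<close>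

lemma AE_hardy_poisson:
  assumes lam: "lam \<ge> 1/2" and exponents: "\<beta> + real m > -1" "\<alpha> + \<beta> + real m + 2 > 0"
  shows "AE t in gegenbauer_measure lam.
    set_integrable lborel {0..1}
      (\<lambda>R. R powr \<alpha> * (LBINT r:{0..R}. r powr \<beta> * poisson_remainder lam m t r)) \<and>
    hardy_poisson lam m \<alpha> \<beta> t =
      (\<integral>p. hardy_kernel \<alpha> \<beta> (fst p) (snd p) * poisson_remainder lam m t (snd p) \<partial>(lborel \<Otimes>\<^sub>M lborel))"
proof -
  let ?W = "gegenbauer_measure lam" and ?L = "(lborel :: real measure) \<Otimes>\<^sub>M (lborel :: real measure)"
  interpret pair_sigma_finite ?W ?L
    by (rule pair_sigma_finite_gegenbauer[OF lam])
  have "AE t in ?W. integrable ?L (\<lambda>p. hardy_kernel \<alpha> \<beta> (fst p) (snd p) * poisson_remainder lam m t (snd p))"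
    using AE_integrable_fst'[OF integrable_hardy_poisson_remainder[OF lam exponents, of "\<lambda>_. 1" 1]]
    by (simp add: case_prod_beta')
  then show ?thesis
  proof (rule eventually_mono)
    fix t
    assume int: "integrable ?L (\<lambda>p. hardy_kernel \<alpha> \<beta> (fst p) (snd p) * poisson_remainder lam m t (snd p))"
    define k where "k R = (\<integral>r. hardy_kernel \<alpha> \<beta> R r * poisson_remainder lam m t r \<partial>lborel)" for R
    define j where "j R = R powr \<alpha> * (LBINT r:{0..R}. r powr \<beta> * poisson_remainder lam m t r)" for R
    have k: "integrable lborel k"
      and k_eq: "(\<integral>R. k R \<partial>lborel) =
        (\<integral>p. hardy_kernel \<alpha> \<beta> (fst p) (snd p) * poisson_remainder lam m t (snd p) \<partial>?L)"
      using lborel_pair.integrable_fst'[OF int] lborel_pair.integral_fst'[OF int]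
      unfolding k_def by simp_all
    \<comment> \<open>Closed intervals and the open region of the kernel differ by null sets: R = 0,
      1 outside and r = 0, R inside.\<close>
    have "indicator {0..1} R * j R = k R" if "R \<noteq> 0 \<and> R \<noteq> 1" for R
    proof (cases "R \<in> {0<..<1}")
      case True
      have "j R = R powr \<alpha> * (\<integral>r. indicator {0<..<R} r * (r powr \<beta> * poisson_remainder lam m t r) \<partial>lborel)"
        unfolding j_def set_lebesgue_integral_def
      proof (intro arg_cong2[where f = "(*)"] refl integral_cong_AE)
        have "AE r in lborel. r \<noteq> 0 \<and> r \<noteq> R"
          using AE_lborel_singleton[of 0] AE_lborel_singleton[of R] by eventually_elim auto
        then show "AE r in lborel. indicat_real {0..R} r *\<^sub>R (r powr \<beta> * poisson_remainder lam m t r) =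
            indicat_real {0<..<R} r * (r powr \<beta> * poisson_remainder lam m t r)"
          by (rule eventually_mono) (auto simp: indicator_def)
      qed measurable
      also have "\<dots> = (\<integral>r. R powr \<alpha> * (indicator {0<..<R} r * (r powr \<beta> * poisson_remainder lam m t r)) \<partial>lborel)"
        by (rule integral_mult_right_zero[symmetric])
      also have "\<dots> = k R"
        unfolding k_def using True
        by (intro Bochner_Integration.integral_cong) (auto simp: hardy_kernel_def indicator_def)
      finally show ?thesis
        using True by simp
    next
      case False
      then have "R \<notin> {0..1}"
        using that by auto
      moreover have "hardy_kernel \<alpha> \<beta> R r = 0" for r
        using False by (auto simp: hardy_kernel_def)
      ultimately show ?thesis
        by (simp add: k_def)
    qed
    moreover have "AE R in lborel. R \<noteq> (0::real) \<and> R \<noteq> 1"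
      using AE_lborel_singleton[of 0] AE_lborel_singleton[of 1] by eventually_elim auto
    ultimately have AE: "AE R in lborel. indicator {0..1} R * j R = k R"
      by (auto elim: eventually_mono)
    have [measurable]: "(\<lambda>R. indicator {0..1} R * j R) \<in> borel_measurable lborel"
      unfolding j_def by measurable
    have [measurable]: "k \<in> borel_measurable lborel"
      using k by (rule borel_measurable_integrable)
    have "integrable lborel (\<lambda>R. indicator {0..1} R * j R)"
      using k AE by (subst integrable_cong_AE[where g = k]) simp_all
    moreover have "(\<integral>R. indicator {0..1} R * j R \<partial>lborel) = (\<integral>R. k R \<partial>lborel)"
      using AE by (intro integral_cong_AE) simp_all
    ultimately show "set_integrable lborel {0..1}
        (\<lambda>R. R powr \<alpha> * (LBINT r:{0..R}. r powr \<beta> * poisson_remainder lam m t r)) \<and>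
      hardy_poisson lam m \<alpha> \<beta> t =
      (\<integral>p. hardy_kernel \<alpha> \<beta> (fst p) (snd p) * poisson_remainder lam m t (snd p) \<partial>?L)"
      unfolding hardy_poisson_def k_eq[symmetric] set_integrable_def
        set_lebesgue_integral_def[where A = "{0..1}"] j_def by simp
  qed
qed

text \<open>After the exchange of integrals, the coefficient of the remainder at fixed r is a
  multiple of r^k, or 0 for k < m. The kernel moment of r^k then supplies the two linear factors in
  the denominator.\<close>

lemma
  assumes lam: "lam \<ge> 1/2" and exponents: "\<beta> + real m > -1" "\<alpha> + \<beta> + real m + 2 > 0"
  shows integrable_hardy_poisson: "integrable (gegenbauer_measure lam) (hardy_poisson lam m \<alpha> \<beta>)"
    and integral_hardy_poisson_gegenbauer:
      "(\<integral>t. hardy_poisson lam m \<alpha> \<beta> t * gegenbauer lam k t \<partial>gegenbauer_measure lam) =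
        (if k < m then 0 else (lam + real k) / lam * gegenbauer_norm lam k
          / ((\<beta> + real k + 1) * (\<alpha> + \<beta> + real k + 2)))"
proof -
  let ?W = "gegenbauer_measure lam" and ?L = "(lborel :: real measure) \<Otimes>\<^sub>M (lborel :: real measure)"
  interpret pair_sigma_finite ?W ?L
    by (rule pair_sigma_finite_gegenbauer[OF lam])
  let ?H = "\<lambda>t p. hardy_kernel \<alpha> \<beta> (fst p) (snd p) * poisson_remainder lam m t (snd p)"
  have int: "integrable ?W (\<lambda>t. \<integral>p. ?H t p \<partial>?L)"
    using integrable_fst'[OF integrable_hardy_poisson_remainder[OF lam exponents, of "\<lambda>_. 1" 1]]
    by (simp add: case_prod_beta')
  have AE: "AE t in ?W. hardy_poisson lam m \<alpha> \<beta> t = (\<integral>p. ?H t p \<partial>?L)"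
    using AE_hardy_poisson[OF lam exponents] by (rule eventually_mono) simp
  have [measurable]: "(\<lambda>t. \<integral>p. ?H t p \<partial>?L) \<in> borel_measurable borel"
    using borel_measurable_integrable[OF int] by simp
  show "integrable ?W (hardy_poisson lam m \<alpha> \<beta>)"
    using int AE by (subst integrable_cong_AE[where g = "\<lambda>t. \<integral>p. ?H t p \<partial>?L"]) simp_all
  obtain B where B: "\<forall>t\<in>{-1..1}. \<bar>gegenbauer lam k t\<bar> \<le> B"
    using gegenbauer_bounded by blast
  have "(\<integral>t. hardy_poisson lam m \<alpha> \<beta> t * gegenbauer lam k t \<partial>?W) =
      (\<integral>t. (\<integral>p. ?H t p \<partial>?L) * gegenbauer lam k t \<partial>?W)"
    using AE by (intro integral_cong_AE) (auto elim: eventually_mono)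
  also have "\<dots> = (\<integral>t. (\<integral>p. ?H t p * gegenbauer lam k t \<partial>?L) \<partial>?W)"
    by simp
  also have "\<dots> = (\<integral>p. (\<integral>t. ?H t p * gegenbauer lam k t \<partial>?W) \<partial>?L)"
    using integrable_hardy_poisson_remainder[OF lam exponents gegenbauer_measurable[of lam k], of B] B
    by (intro Fubini_integral[symmetric]) (simp add: case_prod_beta')
  also have "\<dots> = (\<integral>p. (if k < m then 0 else (lam + real k) / lam * gegenbauer_norm lam k)
      * (hardy_kernel \<alpha> \<beta> (fst p) (snd p) * snd p ^ k) \<partial>?L)"
  proof (rule Bochner_Integration.integral_cong[OF refl])
    fix p :: "real \<times> real"
    obtain R r where p: "p = (R, r)" by fastforce
    show "(\<integral>t. ?H t p * gegenbauer lam k t \<partial>?W) =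
        (if k < m then 0 else (lam + real k) / lam * gegenbauer_norm lam k)
        * (hardy_kernel \<alpha> \<beta> (fst p) (snd p) * snd p ^ k)"
    proof (cases "0 < r \<and> r < R \<and> R < 1")
      case True
      have "(\<integral>t. ?H t p * gegenbauer lam k t \<partial>?W) =
          hardy_kernel \<alpha> \<beta> R r * (\<integral>t. poisson_remainder lam m t r * gegenbauer lam k t \<partial>?W)"
        by (simp add: p mult.assoc)
      then show ?thesis
        using True integral_poisson_remainder_gegenbauer[OF lam, of r m k] by (simp add: p mult_ac)
    next
      case False
      then have "hardy_kernel \<alpha> \<beta> R r = 0"
        by (auto simp: hardy_kernel_def)
      then show ?thesis by (simp add: p)
    qed
  qed
  also have "\<dots> = (if k < m then 0 else (lam + real k) / lam * gegenbauer_norm lam k)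
      * (\<integral>p. hardy_kernel \<alpha> \<beta> (fst p) (snd p) * snd p ^ k \<partial>?L)"
    by (rule integral_mult_right_zero)
  also have "\<dots> = (if k < m then 0 else (lam + real k) / lam * gegenbauer_norm lam k
          / ((\<beta> + real k + 1) * (\<alpha> + \<beta> + real k + 2)))"
  proof (cases "k < m")
    case False
    \<comment> \<open>Both exponent conditions are monotone in the index, so they pass from m to
      every k >= m.\<close>
    then have "real m \<le> real k" by simp
    then show ?thesis
      using exponents False by (subst integral_hardy_kernel) auto
  qed simp
  finally show "(\<integral>t. hardy_poisson lam m \<alpha> \<beta> t * gegenbauer lam k t \<partial>?W) =
        (if k < m then 0 else (lam + real k) / lam * gegenbauer_norm lam k
          / ((\<beta> + real k + 1) * (\<alpha> + \<beta> + real k + 2)))" .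
qed

text \<open>Holds for every t, not merely almost every t: on [0, R] with R < 1 the remainder is
  bounded by a constant times r^m, and only the singularity at 0 matters.\<close>

lemma set_integrable_powr_poisson_remainder:
  assumes "t \<in> {-1..1}" "R \<in> {0<..<1}" "lam > 0" "\<beta> + real m > -1"
  shows "set_integrable lborel {0..R} (\<lambda>r. r powr \<beta> * poisson_remainder lam m t r)"
proof -
  define S where "S = suminf (poisson_term lam 1 R)"
  have "set_integrable lborel {0..R} (\<lambda>r. r powr (\<beta> + real m))"
  proof -
    have "(\<lambda>r. r powr (\<beta> + real m)) integrable_on {0..R}"
      using has_integral_powr_from_0[of "\<beta> + real m" R] assms by (auto simp: integrable_on_def)
    then have "(\<lambda>r. r powr (\<beta> + real m)) absolutely_integrable_on {0..R}"
      by (intro nonnegative_absolutely_integrable_1) auto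
    then show ?thesis
      by (simp add: set_integrable_def integrable_completion)
  qed
  then have int: "integrable lborel (\<lambda>r. (S / R ^ m) * (indicator {0..R} r * r powr (\<beta> + real m)))"
    by (simp add: set_integrable_def)
  show ?thesis
    unfolding set_integrable_def
  proof (rule Bochner_Integration.integrable_bound[OF int], measurable, rule AE_I2)
    fix r
    show "norm (indicator {0..R} r *\<^sub>R (r powr \<beta> * poisson_remainder lam m t r)) \<le>
        norm (S / R ^ m * (indicator {0..R} r * r powr (\<beta> + real m)))"
    proof (cases "0 < r \<and> r \<le> R")
      case True
      have "\<bar>poisson_remainder lam m t r\<bar> \<le> (r / R) ^ m * S"
        unfolding S_def using True assms by (intro poisson_remainder_bound) auto
      also have "\<dots> \<le> \<bar>(r / R) ^ m * S\<bar>"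
        by (rule abs_ge_self)
      finally have "r powr \<beta> * \<bar>poisson_remainder lam m t r\<bar> \<le> r powr \<beta> * \<bar>(r / R) ^ m * S\<bar>"
        by (intro mult_left_mono) auto
      also have "\<dots> = \<bar>S / R ^ m\<bar> * r powr (\<beta> + real m)"
        using True by (simp add: powr_add powr_realpow power_divide abs_mult mult_ac)
      finally show ?thesis
        using True by (simp add: abs_mult)
    next
      case False
      \<comment> \<open>At r = 0 both sides vanish because \<open>0 powr x = 0\<close>; otherwise r
        lies outside the interval.\<close>
      then show ?thesis
        by (cases "r = 0") (auto simp: indicator_def)
    qed
  qed
qed

section \<open>The expansion theorem\<close>

text \<open>The angles in (0, pi) with cosine in a null set N form the image of a subset of N under
  arccos, and differentiable maps preserve null sets. The points -1 and 1 are cut out because arccos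
  is not differentiable there.\<close>

lemma AE_cos:
  assumes "AE t in lborel. t \<in> {-1..1} \<longrightarrow> P t"
  shows "AE \<theta> in lborel. \<theta> \<in> {0..pi} \<longrightarrow> P (cos \<theta>)"
proof -
  obtain N where N: "{t \<in> space lborel. \<not> (t \<in> {-1..1} \<longrightarrow> P t)} \<subseteq> N" "N \<in> null_sets lborel"
    using assms unfolding eventually_ae_filter by blast
  have "negligible (N \<inter> {-1<..<1})"
    by (rule negligible_subset[of N]) (use N(2) in \<open>auto simp: negligible_iff_null_sets null_sets_completionI\<close>)
  moreover have "arccos differentiable_on (N \<inter> {-1<..<1})"
    unfolding differentiable_on_def
  proof
    fix t assume "t \<in> N \<inter> {-1<..<1}"
    then have "(arccos has_real_derivative inverse (- sqrt (1 - t\<^sup>2))) (at t)"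
      by (intro DERIV_arccos) auto
    then show "arccos differentiable (at t within N \<inter> {-1<..<1})"
      using real_differentiable_def differentiable_at_withinI by blast
  qed
  ultimately have "negligible (arccos ` (N \<inter> {-1<..<1}))"
    by (intro negligible_differentiable_image_negligible) auto
  then obtain N' where N': "N' \<in> null_sets lborel" "arccos ` (N \<inter> {-1<..<1}) \<subseteq> N'"
    unfolding negligible_iff_null_sets null_sets_completion_iff2 by blast
  have "AE \<theta> in lborel. \<theta> \<noteq> 0 \<and> \<theta> \<noteq> pi \<and> \<theta> \<notin> N'"
    using AE_lborel_singleton[of 0] AE_lborel_singleton[of pi] AE_not_in[OF N'(1)]
    by eventually_elim auto
  then show ?thesis
  proof (rule eventually_mono, intro impI)
    fix \<theta> assume \<theta>: "\<theta> \<noteq> 0 \<and> \<theta> \<noteq> pi \<and> \<theta> \<notin> N'" "\<theta> \<in> {0..pi}"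
    then have "cos \<theta> < cos 0" "cos pi < cos \<theta>"
      by (auto simp del: cos_zero cos_pi intro!: cos_monotone_0_pi)
    then have "cos \<theta> \<in> {-1<..<1}" by simp
    moreover have "arccos (cos \<theta>) = \<theta>"
      using \<theta> by (simp add: arccos_cos)
    ultimately have "cos \<theta> \<notin> N"
      using \<theta>(1) N'(2) by (metis IntI image_eqI subsetD)
    show "P (cos \<theta>)"
    proof (rule ccontr)
      assume "\<not> P (cos \<theta>)"
      then have "cos \<theta> \<in> {t \<in> space lborel. \<not> (t \<in> {-1..1} \<longrightarrow> P t)}"
        using \<open>cos \<theta> \<in> {-1<..<1}\<close> by simp
      with N(1) \<open>cos \<theta> \<notin> N\<close> show False by blast
    qed
  qed
qed

lemma gegenbauer_expansion_unique:
  fixes lam :: real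
  assumes n: "n \<ge> 2" and lam: "lam = (real n - 1) / 2"
    and F: "integrable (gegenbauer_measure lam) F"
      "\<And>l. (\<integral>t. F t * gegenbauer lam l t \<partial>gegenbauer_measure lam) = c l * gegenbauer_norm lam l"
    and G: "has_gegenbauer_expansion n G c"
  shows "AE t in gegenbauer_measure lam. G t = F t"
proof -
  let ?W = "gegenbauer_measure lam"
  \<comment> \<open>Outside [-1, 1] the profile G is arbitrary and may fail to be measurable, so it
    is cut off there.\<close>
  define G1 where "G1 t = indicator {-1..1} t * G t" for t
  have half: "lam \<ge> 1/2" using n lam by simp
  have G1: "G1 t = G t" if "t \<in> {-1..1}" for t
    using that by (simp add: G1_def)
  have "zonal_L1 n G"
    using G by (simp add: has_gegenbauer_expansion_def)
  then have meas [measurable]: "G1 \<in> borel_measurable borel"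
    using zonal_L1_borel_measurable[of n G] n unfolding G1_def by simp
  have int: "integrable ?W G1"
    using \<open>zonal_L1 n G\<close> zonal_L1_cong[of G1 G n, OF G1] zonal_L1_iff[OF meas, of n] n
    unfolding lam by simp
  have "(\<integral>t. G1 t * gegenbauer lam l t \<partial>?W) = c l * gegenbauer_norm lam l" for l
  proof -
    have "c l = gegenbauer_coeff lam G1 l"
      using G gegenbauer_coeff_cong[of G1 G, OF G1] by (simp add: has_gegenbauer_expansion_def lam)
    then show ?thesis
      using gegenbauer_norm_pos[OF half, of l] by (simp add: gegenbauer_coeff_eq)
  qed
  then have zero: "(\<integral>t. (G1 t - F t) * gegenbauer lam l t \<partial>?W) = 0" for l
    using F(2)[of l] integrable_mult_gegenbauer[OF int, of l] integrable_mult_gegenbauer[OF F(1), of l]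
    by (simp add: left_diff_distrib)
  have "AE t in ?W. G1 t - F t = 0"
    using half int F(1) by (intro gegenbauer_complete zero) auto
  then show ?thesis
    using AE_gegenbauer_measure_interval[of lam] by eventually_elim (simp add: G1_def)
qed

text \<open>G is known only through its coefficients, hence up to null sets, so the formula is
  claimed for every such G, and existence keeps the claim from being vacuous. The integrability
  clauses ensure that no integral takes its default value 0.\<close>

theorem theorem4p3:
  fixes n :: nat and lam L a :: real and L0 :: int
    and c :: "nat \<Rightarrow> real" and rest inner :: "real \<Rightarrow> real \<Rightarrow> real"
  assumes n: "n \<ge> 2"
    and lam: "lam = (real n - 1) / 2"
    and L: "L \<notin> \<int>"
    and a: "a = L * (real n + L - 1)"
    and L0: "L0 = max \<lfloor>L\<rfloor> \<lfloor>- real n - L + 1\<rfloor>"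
    and c: "\<And>l. c l = 1 / (a - real l * (real n + real l - 1)) * ((lam + real l) / lam)"
    and rest: "\<And>t r. rest t r = sphere_area n * poisson_kernel n r t
        - (\<Sum>l | int l \<le> L0. r ^ l * ((lam + real l) / lam) * gegenbauer lam l t)"
    and inner: "\<And>t R. inner t R = (LBINT r:{0..R}. r powr (real n + L - 2) * rest t r)"
  shows "(\<exists>G. has_gegenbauer_expansion n G c) \<and>
    (\<forall>G. has_gegenbauer_expansion n G c \<longrightarrow>
      (AE \<theta> in lborel. \<theta> \<in> {0..pi} \<longrightarrow>
        (\<forall>R\<in>{0<..<1}. set_integrable lborel {0..R} (\<lambda>r. r powr (real n + L - 2) * rest (cos \<theta>) r)) \<and>
        set_integrable lborel {0..1} (\<lambda>R. R powr (- (real n + 2 * L)) * inner (cos \<theta>) R) \<and>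
        G (cos \<theta>) =
          - (LBINT R:{0..1}. R powr (- (real n + 2 * L)) * inner (cos \<theta>) R)
          + (\<Sum>l | int l \<le> L0. c l * gegenbauer lam l (cos \<theta>))))"
proof -
  let ?W = "gegenbauer_measure lam"
  \<comment> \<open>The number of indices l with l <= L0; for L0 < 0 the truncation by
    \<open>nat\<close> gives 0 and an empty sum.\<close>
  define m where "m = nat (L0 + 1)"
  define \<alpha> \<beta> where "\<alpha> = - (real n + 2 * L)" and "\<beta> = real n + L - 2"
  define F where "F t = - hardy_poisson lam m \<alpha> \<beta> t + (\<Sum>l<m. c l * gegenbauer lam l t)" for t
  have half: "lam \<ge> 1/2" and lam0: "lam > 0"
    using n lam by simp_all
  have index: "{l. int l \<le> L0} = {..<m}"
    by (auto simp: m_def)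
  \<comment> \<open>These bounds amount to k - L > 0 and n + L + k - 1 > 0 for k >= m, the two
    exponent conditions.\<close>
  have "L < real_of_int (L0 + 1)" "- real n - L + 1 < real_of_int (L0 + 1)"
    unfolding L0 by linarith+
  moreover have "real_of_int (L0 + 1) \<le> real m"
    unfolding m_def by linarith
  ultimately have m: "L < real m" "- real n - L + 1 < real m"
    by linarith+
  have exponents: "\<beta> + real m > -1" "\<alpha> + \<beta> + real m + 2 > 0"
    using m by (simp_all add: \<alpha>_def \<beta>_def)
  have "sphere_area n > 0"
    unfolding sphere_area_def by (intro divide_pos_pos mult_pos_pos Gamma_real_pos) auto
  then have "sphere_area n * poisson_kernel n r t = suminf (poisson_term lam t r)" for t r
    by (simp add: poisson_kernel_def Let_def lam poisson_term_def[abs_def])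
  then have rest_eq: "rest t r = poisson_remainder lam m t r" for t r
    by (simp add: rest index poisson_remainder_def poisson_term_def)
  have F: "integrable ?W F"
    unfolding F_def using integrable_hardy_poisson[OF half exponents] integrable_gegenbauer[OF half]
    by (intro Bochner_Integration.integrable_add Bochner_Integration.integrable_minus
          Bochner_Integration.integrable_sum integrable_mult_right) auto
  have F_meas [measurable]: "F \<in> borel_measurable borel"
    using borel_measurable_integrable[OF F] by simp
  have coeff: "(\<integral>t. F t * gegenbauer lam k t \<partial>?W) = c k * gegenbauer_norm lam k" for k
  proof -
    have "F t * gegenbauer lam k t = - (hardy_poisson lam m \<alpha> \<beta> t * gegenbauer lam k t)
        + (\<Sum>l<m. c l * (gegenbauer lam l t * gegenbauer lam k t))" for t
      by (simp only: F_def distrib_right sum_distrib_right mult.assoc mult_minus_left)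
    then have "(\<integral>t. F t * gegenbauer lam k t \<partial>?W) =
        - (\<integral>t. hardy_poisson lam m \<alpha> \<beta> t * gegenbauer lam k t \<partial>?W)
        + (\<Sum>l<m. c l * (\<integral>t. gegenbauer lam l t * gegenbauer lam k t \<partial>?W))"
      using integrable_mult_gegenbauer[OF integrable_hardy_poisson[OF half exponents], of k]
        integrable_mult_gegenbauer[OF integrable_gegenbauer[OF half]]
      by (simp add: Bochner_Integration.integral_sum del: minus_add_distrib add_uminus_conv_diff uminus_add_conv_diff)
    also have "(\<Sum>l<m. c l * (\<integral>t. gegenbauer lam l t * gegenbauer lam k t \<partial>?W)) =
        (\<Sum>l<m. if l = k then c k * gegenbauer_norm lam k else 0)"
      using gegenbauer_orthogonal[OF half] by (intro sum.cong) (auto simp: gegenbauer_norm_def)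
    also have "\<dots> = (if k < m then c k * gegenbauer_norm lam k else 0)"
      by simp
    also have "- (\<integral>t. hardy_poisson lam m \<alpha> \<beta> t * gegenbauer lam k t \<partial>?W) =
        (if k < m then 0 else c k * gegenbauer_norm lam k)"
    proof (cases "k < m")
      case True
      then show ?thesis
        using integral_hardy_poisson_gegenbauer[OF half exponents, of k] by simp
    next
      case False
      define D where "D = a - real k * (real n + real k - 1)"
      \<comment> \<open>The factors are n + L + k - 1 and k - L. Their product is minus the
        denominator of \<open>c k\<close>, which accounts for the sign in front of the
        integral.\<close>
      have "(\<beta> + real k + 1) * (\<alpha> + \<beta> + real k + 2) = - D"
        by (simp add: \<alpha>_def \<beta>_def D_def a algebra_simps)
      then show ?thesis
        using integral_hardy_poisson_gegenbauer[OF half exponents, of k] False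
        by (simp add: c D_def[symmetric] mult.commute)
    qed
    finally show ?thesis by simp
  qed
  have "has_gegenbauer_expansion n F c"
    unfolding has_gegenbauer_expansion_def
  proof (intro conjI allI)
    show "zonal_L1 n F"
      using F n by (subst zonal_L1_iff) (auto simp: lam)
    show "gegenbauer_coeff ((real n - 1) / 2) F l = c l" for l
      using coeff[of l] gegenbauer_norm_pos[OF half, of l]
      by (simp add: gegenbauer_coeff_eq flip: lam)
  qed
  moreover have "AE \<theta> in lborel. \<theta> \<in> {0..pi} \<longrightarrow>
        (\<forall>R\<in>{0<..<1}. set_integrable lborel {0..R} (\<lambda>r. r powr \<beta> * rest (cos \<theta>) r)) \<and>
        set_integrable lborel {0..1} (\<lambda>R. R powr \<alpha> * inner (cos \<theta>) R) \<and>
        G (cos \<theta>) = - (LBINT R:{0..1}. R powr \<alpha> * inner (cos \<theta>) R)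
          + (\<Sum>l | int l \<le> L0. c l * gegenbauer lam l (cos \<theta>))"
    if G: "has_gegenbauer_expansion n G c" for G
  proof (rule AE_cos, subst AE_gegenbauer_measure_iff[where lam = lam, symmetric])
    show "AE t in ?W.
        (\<forall>R\<in>{0<..<1}. set_integrable lborel {0..R} (\<lambda>r. r powr \<beta> * rest t r)) \<and>
        set_integrable lborel {0..1} (\<lambda>R. R powr \<alpha> * inner t R) \<and>
        G t = - (LBINT R:{0..1}. R powr \<alpha> * inner t R)
          + (\<Sum>l | int l \<le> L0. c l * gegenbauer lam l t)"
      using AE_gegenbauer_measure_interval[of lam] AE_hardy_poisson[OF half exponents]
        gegenbauer_expansion_unique[OF n lam F coeff G]
    proof eventually_elim
      case (elim t)
      have inner_eq: "inner t R = (LBINT r:{0..R}. r powr \<beta> * poisson_remainder lam m t r)" for R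
        unfolding inner rest_eq \<beta>_def ..
      show ?case
        unfolding rest_eq inner_eq index hardy_poisson_def[symmetric]
        using elim set_integrable_powr_poisson_remainder[OF elim(1) _ lam0 exponents(1)]
        by (simp add: F_def)
    qed
  qed
  ultimately show ?thesis
    unfolding \<alpha>_def \<beta>_def by (intro conjI exI[of _ F] allI impI)
qed

end
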